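(* Let $(M,R^M)$ be a bridge magma, let $E$ be a sharp, categorical, omega magma equivalence relation on $M$, and assume $R^M$ is a witness to $E$. Then the quotient map induces a categorical Penon morphism $$\kappa_E:(M,R^M)\to(M//E,R^\Delta).$$
   Context: A globular set $X$ is a sequence of sets $X_i$ ($i\ge 0$; elements are called $i$-cells) with functions $dom_{i-1}^i,cod_{i-1}^i:X_i\to X_{i-1}$ ($i>0$) satisfying $dom_{i-1}^i dom_i^{i+1}=dom_{i-1}^i cod_i^{i+1}$ and $cod_{i-1}^i dom_i^{i+1}=cod_{i-1}^i cod_i^{i+1}$. For $i<j$, $dom_i^j,cod_i^j:X_j\to X_i$ are the iterated composites. An omega graph is a globular set with functions $id_i^{i-1}:X_{i-1}\to X_i$ ($i>0$) with $dom_{i-1}^i id_i^{i-1}x=x=cod_{i-1}^i id_i^{i-1}x$; $id_j^i$ denotes the iterated composite $X_i\to X_j$. An omega magma is an omega graph with, for all $0\le i<j$, a partial binary operation $a\circ_i^j b$ on $j$-cells, defined exactly when $cod_i^j a=dom_i^j b$, such that: if $i+1=j$, then $dom_i^j(a\circ_i^j b)=dom_i^j a$ and $cod_i^j(a\circ_i^j b)=cod_i^j b$; if $i+1<j$, then $dom_{j-1}^j(a\circ_i^j b)=dom_{j-1}^ja\circ_i^{j-1}dom_{j-1}^jb$ and likewise for $cod_{j-1}^j$. Morphisms of globular sets, omega graphs and omega magmas preserve all the respective structure. A strict omega category is an omega magma in which (whenever the composites are defined) $(a\circ_i^jb)\circ_i^jc=a\circ_i^j(b\circ_i^jc)$; $(a\circ_j^kb)\circ_i^k(c\circ_j^kd)=(a\circ_i^kc)\circ_j^k(b\circ_i^kd)$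 for $i<j<k$; $a=id_j^i(dom_i^ja)\circ_i^ja=a\circ_i^jid_j^i(cod_i^ja)$; and $id_{j+1}^j(a)\circ_i^{j+1}id_{j+1}^j(b)=id_{j+1}^j(a\circ_i^jb)$ for $i<j$. Two $i$-cells $a,b$ are parallel, $a\parallel b$, if they have the same $dom_{i-1}^i$ and the same $cod_{i-1}^i$; any two $0$-cells are parallel. A bridge relation $R$ on an omega magma $X$ is a sequence $R_i\subseteq X_i\times X_i\times X_{i+1}$ ($i\ge0$) such that: $(a,b,c)\in R_i$ implies $a\parallel b$, $dom_i^{i+1}c=a$, $cod_i^{i+1}c=b$; $(a,a,id_{i+1}^ia)\in R_i$ for all $a\in X_i$; $(a,b,c),(a,b,d)\in R_i$ implies $c=d$. The pair $(X,R)$ is called a bridge magma. The diagonal bridge relation $R^\Delta$ consists of all triples $(a,a,id_{i+1}^ia)$. A bridge morphism $F:(X,R^X)\to(Y,R^Y)$ is an omega magma morphism with $(a,b,c)\in R_i^X\Rightarrow(Fa,Fb,Fc)\in R_i^Y$. A categorical Penon morphism is a bridge morphism $F:(X,R^X)\to(Y,R^Y)$ such that $Y$ is a strict omega category, $R^Y=R^\Delta$; $(a,b,c)\in R_i^X$ implies $Fa=Fb$ and $Fc=id_{i+1}^i(Fa)$; and if $a,b\in X_i$, $a\parallel b$, $Fa=Fb$, then there is $c$ with $(a,b,c)\in R_i^X$. An omega magma equivalence relation on $M$ is an omega submagma $E\subseteq M\times M$ such that $E_j$ is an equivalence relation on $M_j$ for all $j\ge0$. $M//E$ is the coequalizer,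 in the category of omega magmas, of the two projections $E\rightrightarrows M$. Let $UM$ be the omega graph underlying $M$, $L(UM)$ the omega magma freely generated by $UM$, and $C(UM)$ the strict omega category freely generated by $UM$; let $\varepsilon_M:L(UM)\to M$ be the counit and $\eta_M:L(UM)\to C(UM)$ the canonical omega magma morphism (the unit of the adjunction between strict omega categories and omega magmas). $E$ is categorical if for all $u,v\in L(UM)$, $\eta_Mu=\eta_Mv$ implies $(\varepsilon_Mu,\varepsilon_Mv)\in E$. $E$ is sharp if, for $j$-cells $a,b$ of $M$ and $k<j$, $(cod_k^ja,dom_k^jb)\in E$ implies that there exist $a',b'\in M$ with $(a,a'),(b,b')\in E$ and $cod_k^ja'=dom_k^jb'$. $R^M$ is a witness to $E$ if (1) $(a,b,c)\in R_j^M$ implies $(a,b)\in E$ and $(c,id_{j+1}^ja),(c,id_{j+1}^jb)\in E$; and (2) $a\parallel b$ and $(a,b)\in E_j$ implies there is $c$ with $(a,b,c)\in R_j^M$. *)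

theory Defs
  imports Main
begin

section \<open>Globular sets, omega graphs, omega magmas, strict omega categories\<close>

text \<open>
  The operations are indexed by the lower of the two adjacent dimensions:
  \<open>Dom X i\<close> and \<open>Cod X i\<close> go from \<open>(i+1)\<close>-cells to \<open>i\<close>-cells, and \<open>Idn X i\<close> from
  \<open>i\<close>-cells to \<open>(i+1)\<close>-cells.  \<open>Comp X i j a b\<close> is the composite of the \<open>j\<close>-cells \<open>a\<close> and
  \<open>b\<close> along \<open>i\<close>-cells, in diagrammatic order.  It is a total HOL function whose values are
  meaningful only under \<open>composable X i j a b\<close>.
\<close>

record 'a globular_set =
  Cell :: "nat \<Rightarrow> 'a set"
  Dom :: "nat \<Rightarrow> 'a \<Rightarrow> 'a"
  Cod :: "nat \<Rightarrow> 'a \<Rightarrow> 'a"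

record 'a omega_graph = "'a globular_set" +
  Idn :: "nat \<Rightarrow> 'a \<Rightarrow> 'a"

record 'a omega_magma = "'a omega_graph" +
  Comp :: "nat \<Rightarrow> nat \<Rightarrow> 'a \<Rightarrow> 'a \<Rightarrow> 'a"

locale globular_set =
  fixes X :: "('a, 'm) globular_set_scheme" (structure)
  assumes Dom_closed: "x \<in> Cell X (Suc i) \<Longrightarrow> Dom X i x \<in> Cell X i"
    and Cod_closed: "x \<in> Cell X (Suc i) \<Longrightarrow> Cod X i x \<in> Cell X i"
    and Dom_Dom: "x \<in> Cell X (Suc (Suc i)) \<Longrightarrow> Dom X i (Dom X (Suc i) x) = Dom X i (Cod X (Suc i) x)"
    and Cod_Dom: "x \<in> Cell X (Suc (Suc i)) \<Longrightarrow> Cod X i (Dom X (Suc i) x) = Cod X i (Cod X (Suc i) x)"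

text \<open>
  \<open>dom_to X i j\<close>, \<open>cod_to X i j\<close> (for \<open>i \<le> j\<close>) are the iterated maps from \<open>j\<close>-cells to
  \<open>i\<close>-cells, and \<open>id_to X i j\<close> is the iterated identity from \<open>i\<close>-cells to \<open>j\<close>-cells;
  for \<open>i = j\<close> they are the identity function.
\<close>

fun dom_to :: "('a, 'm) globular_set_scheme \<Rightarrow> nat \<Rightarrow> nat \<Rightarrow> 'a \<Rightarrow> 'a" where
  "dom_to X i 0 x = x"
| "dom_to X i (Suc j) x = (if i \<le> j then dom_to X i j (Dom X j x) else x)"

fun cod_to :: "('a, 'm) globular_set_scheme \<Rightarrow> nat \<Rightarrow> nat \<Rightarrow> 'a \<Rightarrow> 'a" where
  "cod_to X i 0 x = x"
| "cod_to X i (Suc j) x = (if i \<le> j then cod_to X i j (Cod X j x) else x)"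

fun id_to :: "('a, 'm) omega_graph_scheme \<Rightarrow> nat \<Rightarrow> nat \<Rightarrow> 'a \<Rightarrow> 'a" where
  "id_to X i 0 x = x"
| "id_to X i (Suc j) x = (if i \<le> j then Idn X j (id_to X i j x) else x)"

definition parallel :: "('a, 'm) globular_set_scheme \<Rightarrow> nat \<Rightarrow> 'a \<Rightarrow> 'a \<Rightarrow> bool" where
  "parallel X i a b \<longleftrightarrow> a \<in> Cell X i \<and> b \<in> Cell X i \<and>
     (\<forall>k. i = Suc k \<longrightarrow> Dom X k a = Dom X k b \<and> Cod X k a = Cod X k b)"

locale omega_graph = globular_set X for X :: "('a, 'm) omega_graph_scheme" (structure) +
  assumes Idn_closed: "x \<in> Cell X i \<Longrightarrow> Idn X i x \<in> Cell X (Suc i)"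
    and Dom_Idn: "x \<in> Cell X i \<Longrightarrow> Dom X i (Idn X i x) = x"
    and Cod_Idn: "x \<in> Cell X i \<Longrightarrow> Cod X i (Idn X i x) = x"

definition composable :: "('a, 'm) globular_set_scheme \<Rightarrow> nat \<Rightarrow> nat \<Rightarrow> 'a \<Rightarrow> 'a \<Rightarrow> bool" where
  "composable X i j a b \<longleftrightarrow>
     i < j \<and> a \<in> Cell X j \<and> b \<in> Cell X j \<and> cod_to X i j a = dom_to X i j b"

locale omega_magma = omega_graph X for X :: "('a, 'm) omega_magma_scheme" (structure) +
  assumes Comp_closed: "composable X i j a b \<Longrightarrow> Comp X i j a b \<in> Cell X j"
    and Dom_Comp: "composable X i (Suc i) a b \<Longrightarrow> Dom X i (Comp X i (Suc i) a b) = Dom X i a"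
    and Cod_Comp: "composable X i (Suc i) a b \<Longrightarrow> Cod X i (Comp X i (Suc i) a b) = Cod X i b"
    and Dom_Comp': "i < j \<Longrightarrow> composable X i (Suc j) a b \<Longrightarrow>
           Dom X j (Comp X i (Suc j) a b) = Comp X i j (Dom X j a) (Dom X j b)"
    and Cod_Comp': "i < j \<Longrightarrow> composable X i (Suc j) a b \<Longrightarrow>
           Cod X j (Comp X i (Suc j) a b) = Comp X i j (Cod X j a) (Cod X j b)"

locale strict_omega_category = omega_magma X for X :: "('a, 'm) omega_magma_scheme" (structure) +
  assumes assoc:
      "composable X i j a b \<Longrightarrow> composable X i j (Comp X i j a b) c \<Longrightarrow>
       composable X i j b c \<Longrightarrow> composable X i j a (Comp X i j b c) \<Longrightarrow>
       Comp X i j (Comp X i j a b) c = Comp X i j a (Comp X i j b c)"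
    and interchange:
      "i < j \<Longrightarrow> j < k \<Longrightarrow>
       composable X j k a b \<Longrightarrow> composable X j k c d \<Longrightarrow>
       composable X i k (Comp X j k a b) (Comp X j k c d) \<Longrightarrow>
       composable X i k a c \<Longrightarrow> composable X i k b d \<Longrightarrow>
       composable X j k (Comp X i k a c) (Comp X i k b d) \<Longrightarrow>
       Comp X i k (Comp X j k a b) (Comp X j k c d) = Comp X j k (Comp X i k a c) (Comp X i k b d)"
    and id_left: "i < j \<Longrightarrow> a \<in> Cell X j \<Longrightarrow> Comp X i j (id_to X i j (dom_to X i j a)) a = a"
    and id_right: "i < j \<Longrightarrow> a \<in> Cell X j \<Longrightarrow> Comp X i j a (id_to X i j (cod_to X i j a)) = a"
    and Idn_Comp: "composable X i j a b \<Longrightarrow>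
       Comp X i (Suc j) (Idn X j a) (Idn X j b) = Idn X j (Comp X i j a b)"

definition underlying_graph :: "('a, 'm) omega_magma_scheme \<Rightarrow> 'a omega_graph" where
  "underlying_graph M = \<lparr>Cell = Cell M, Dom = Dom M, Cod = Cod M, Idn = Idn M\<rparr>"

section \<open>Morphisms\<close>

definition globular_set_morphism ::
  "('a, 'm) globular_set_scheme \<Rightarrow> ('b, 'n) globular_set_scheme \<Rightarrow> (nat \<Rightarrow> 'a \<Rightarrow> 'b) \<Rightarrow> bool" where
  "globular_set_morphism X Y F \<longleftrightarrow>
     (\<forall>i. \<forall>x\<in>Cell X i. F i x \<in> Cell Y i) \<and>
     (\<forall>i. \<forall>x\<in>Cell X (Suc i). F i (Dom X i x) = Dom Y i (F (Suc i) x)) \<and>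
     (\<forall>i. \<forall>x\<in>Cell X (Suc i). F i (Cod X i x) = Cod Y i (F (Suc i) x))"

definition omega_graph_morphism ::
  "('a, 'm) omega_graph_scheme \<Rightarrow> ('b, 'n) omega_graph_scheme \<Rightarrow> (nat \<Rightarrow> 'a \<Rightarrow> 'b) \<Rightarrow> bool" where
  "omega_graph_morphism X Y F \<longleftrightarrow> globular_set_morphism X Y F \<and>
     (\<forall>i. \<forall>x\<in>Cell X i. F (Suc i) (Idn X i x) = Idn Y i (F i x))"

definition omega_magma_morphism ::
  "('a, 'm) omega_magma_scheme \<Rightarrow> ('b, 'n) omega_magma_scheme \<Rightarrow> (nat \<Rightarrow> 'a \<Rightarrow> 'b) \<Rightarrow> bool" where
  "omega_magma_morphism X Y F \<longleftrightarrow> omega_graph_morphism X Y F \<and>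
     (\<forall>i j a b. composable X i j a b \<longrightarrow> F j (Comp X i j a b) = Comp Y i j (F j a) (F j b))"

text \<open>Families of functions represent the same morphism out of \<open>X\<close> iff they agree on the cells of \<open>X\<close>.\<close>

definition eq_on_cells ::
  "('a, 'm) globular_set_scheme \<Rightarrow> (nat \<Rightarrow> 'a \<Rightarrow> 'b) \<Rightarrow> (nat \<Rightarrow> 'a \<Rightarrow> 'b) \<Rightarrow> bool" where
  "eq_on_cells X F G \<longleftrightarrow> (\<forall>j. \<forall>x\<in>Cell X j. F j x = G j x)"

section \<open>Omega magmas presented by generators and relations\<close>

text \<open>
  Raw terms over the cells of an omega graph.  A term carries no dimension; it is always used
  together with one, and \<open>Cmp i t s\<close>, taken in dimension \<open>j\<close>, stands for \<open>t \<circ>\<^sub>i\<^sup>j s\<close>.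
\<close>

datatype 'a trm = Gen 'a | Unit "'a trm" | Cmp nat "'a trm" "'a trm"

primrec tdom :: "('a, 'm) globular_set_scheme \<Rightarrow> nat \<Rightarrow> 'a trm \<Rightarrow> 'a trm" where
  "tdom G j (Gen x) = Gen (Dom G j x)"
| "tdom G j (Unit t) = t"
| "tdom G j (Cmp i t s) = (if i = j then tdom G j t else Cmp i (tdom G j t) (tdom G j s))"

primrec tcod :: "('a, 'm) globular_set_scheme \<Rightarrow> nat \<Rightarrow> 'a trm \<Rightarrow> 'a trm" where
  "tcod G j (Gen x) = Gen (Cod G j x)"
| "tcod G j (Unit t) = t"
| "tcod G j (Cmp i t s) = (if i = j then tcod G j s else Cmp i (tcod G j t) (tcod G j s))"

text \<open>
  The structure operations on raw terms, bundled so that \<open>dom_to\<close>, \<open>cod_to\<close> and \<open>id_to\<close> apply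
  to terms (on raw terms this is not yet an omega graph).
\<close>

definition trms :: "('a, 'm) globular_set_scheme \<Rightarrow> 'a trm omega_graph" where
  "trms G = \<lparr>Cell = (\<lambda>_. UNIV), Dom = tdom G, Cod = tcod G, Idn = (\<lambda>_. Unit)\<rparr>"

text \<open>
  The partial congruence on raw terms generated by the omega graph \<open>G\<close>, the omega magma axioms
  and the relations \<open>S\<close>.  Definedness and equality are generated together, since composability
  depends on equality: \<open>cong G S j t t\<close> says that \<open>t\<close> denotes a \<open>j\<close>-cell, and
  \<open>cong G S j t s\<close> that \<open>t\<close> and \<open>s\<close> denote the same \<open>j\<close>-cell.  A pair in \<open>S j\<close> is only
  imposed when both of its sides denote \<open>j\<close>-cells.
\<close>

inductive cong ::
  "('a, 'm) omega_graph_scheme \<Rightarrow> (nat \<Rightarrow> ('a trm \<times> 'a trm) set) \<Rightarrow> nat \<Rightarrow> 'a trm \<Rightarrow> 'a trm \<Rightarrow> bool"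
  for G S where
  cong_gen: "x \<in> Cell G j \<Longrightarrow> cong G S j (Gen x) (Gen x)"
| cong_sym: "cong G S j t s \<Longrightarrow> cong G S j s t"
| cong_trans: "cong G S j t s \<Longrightarrow> cong G S j s r \<Longrightarrow> cong G S j t r"
| cong_dom: "cong G S (Suc j) t s \<Longrightarrow> cong G S j (tdom G j t) (tdom G j s)"
| cong_cod: "cong G S (Suc j) t s \<Longrightarrow> cong G S j (tcod G j t) (tcod G j s)"
| cong_dom_dom: "cong G S (Suc (Suc j)) t t \<Longrightarrow>
    cong G S j (tdom G j (tdom G (Suc j) t)) (tdom G j (tcod G (Suc j) t))"
| cong_cod_dom: "cong G S (Suc (Suc j)) t t \<Longrightarrow>
    cong G S j (tcod G j (tdom G (Suc j) t)) (tcod G j (tcod G (Suc j) t))"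
| cong_unit: "cong G S j t s \<Longrightarrow> cong G S (Suc j) (Unit t) (Unit s)"
| cong_gen_unit: "x \<in> Cell G j \<Longrightarrow> cong G S (Suc j) (Unit (Gen x)) (Gen (Idn G j x))"
| cong_cmp: "i < j \<Longrightarrow> cong G S j t t' \<Longrightarrow> cong G S j s s' \<Longrightarrow>
    cong G S i (cod_to (trms G) i j t) (dom_to (trms G) i j s) \<Longrightarrow>
    cong G S j (Cmp i t s) (Cmp i t' s')"
| cong_rel: "(t, s) \<in> S j \<Longrightarrow> cong G S j t t \<Longrightarrow> cong G S j s s \<Longrightarrow> cong G S j t s"

definition cls ::
  "('a, 'm) omega_graph_scheme \<Rightarrow> (nat \<Rightarrow> ('a trm \<times> 'a trm) set) \<Rightarrow> nat \<Rightarrow> 'a trm \<Rightarrow> 'a trm set" where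
  "cls G S j t = {s. cong G S j t s}"

definition presented ::
  "('a, 'm) omega_graph_scheme \<Rightarrow> (nat \<Rightarrow> ('a trm \<times> 'a trm) set) \<Rightarrow> 'a trm set omega_magma" where
  "presented G S =
    \<lparr>Cell = (\<lambda>j. {cls G S j t | t. cong G S j t t}),
     Dom = (\<lambda>j A. \<Union>t\<in>A. cls G S j (tdom G j t)),
     Cod = (\<lambda>j A. \<Union>t\<in>A. cls G S j (tcod G j t)),
     Idn = (\<lambda>j A. \<Union>t\<in>A. cls G S (Suc j) (Unit t)),
     Comp = (\<lambda>i j A B. \<Union>t\<in>A. \<Union>s\<in>B. cls G S j (Cmp i t s))\<rparr>"

definition gen ::
  "('a, 'm) omega_graph_scheme \<Rightarrow> (nat \<Rightarrow> ('a trm \<times> 'a trm) set) \<Rightarrow> nat \<Rightarrow> 'a \<Rightarrow> 'a trm set" where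
  "gen G S j x = cls G S j (Gen x)"

text \<open>
  Evaluation of terms in an omega magma \<open>N\<close> along a map \<open>f\<close> of generators, and the map it
  induces on classes of terms.
\<close>

primrec eval :: "('b, 'n) omega_magma_scheme \<Rightarrow> (nat \<Rightarrow> 'a \<Rightarrow> 'b) \<Rightarrow> nat \<Rightarrow> 'a trm \<Rightarrow> 'b" where
  "eval N f j (Gen x) = f j x"
| "eval N f j (Unit t) = Idn N (j - 1) (eval N f (j - 1) t)"
| "eval N f j (Cmp i t s) = Comp N i j (eval N f j t) (eval N f j s)"

definition extend_map ::
  "('b, 'n) omega_magma_scheme \<Rightarrow> (nat \<Rightarrow> 'a \<Rightarrow> 'b) \<Rightarrow> nat \<Rightarrow> 'a trm set \<Rightarrow> 'b" where
  "extend_map N f j A = eval N f j (SOME t. t \<in> A)"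

section \<open>Free omega magmas and free strict omega categories\<close>

text \<open>
  Their universal properties, against targets with cells in an arbitrary type, are
  \<open>free_omega_magma_universal\<close>, \<open>free_strict_category_universal\<close> and
  \<open>canonical_map_universal\<close> below.
\<close>

definition free_omega_magma :: "('a, 'm) omega_graph_scheme \<Rightarrow> 'a trm set omega_magma" where
  "free_omega_magma G = presented G (\<lambda>_. {})"

inductive strict_axiom ::
  "('a, 'm) omega_graph_scheme \<Rightarrow> nat \<Rightarrow> 'a trm \<Rightarrow> 'a trm \<Rightarrow> bool" for G where
  "i < j \<Longrightarrow> strict_axiom G j (Cmp i (Cmp i a b) c) (Cmp i a (Cmp i b c))"
| "i < j \<Longrightarrow> j < k \<Longrightarrow>
     strict_axiom G k (Cmp i (Cmp j a b) (Cmp j c d)) (Cmp j (Cmp i a c) (Cmp i b d))"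
| "i < j \<Longrightarrow> strict_axiom G j (Cmp i (id_to (trms G) i j (dom_to (trms G) i j a)) a) a"
| "i < j \<Longrightarrow> strict_axiom G j (Cmp i a (id_to (trms G) i j (cod_to (trms G) i j a))) a"
| "i < j \<Longrightarrow> strict_axiom G (Suc j) (Cmp i (Unit a) (Unit b)) (Unit (Cmp i a b))"

definition strict_rels :: "('a, 'm) omega_graph_scheme \<Rightarrow> nat \<Rightarrow> ('a trm \<times> 'a trm) set" where
  "strict_rels G j = {(t, s). strict_axiom G j t s}"

definition free_strict_category :: "('a, 'm) omega_graph_scheme \<Rightarrow> 'a trm set omega_magma" where
  "free_strict_category G = presented G (strict_rels G)"

definition counit :: "('a, 'm) omega_magma_scheme \<Rightarrow> nat \<Rightarrow> 'a trm set \<Rightarrow> 'a" where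
  "counit M = extend_map M (\<lambda>_ x. x)"

definition canonical_map :: "('a, 'm) omega_magma_scheme \<Rightarrow> nat \<Rightarrow> 'a trm set \<Rightarrow> 'a trm set" where
  "canonical_map M =
     extend_map (free_strict_category (underlying_graph M))
       (gen (underlying_graph M) (strict_rels (underlying_graph M)))"

section \<open>Equivalence relations and quotients of omega magmas\<close>

definition prod_magma ::
  "('a, 'm) omega_magma_scheme \<Rightarrow> ('b, 'n) omega_magma_scheme \<Rightarrow> ('a \<times> 'b) omega_magma" where
  "prod_magma X Y =
    \<lparr>Cell = (\<lambda>j. Cell X j \<times> Cell Y j),
     Dom = (\<lambda>j. map_prod (Dom X j) (Dom Y j)),
     Cod = (\<lambda>j. map_prod (Cod X j) (Cod Y j)),
     Idn = (\<lambda>j. map_prod (Idn X j) (Idn Y j)),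
     Comp = (\<lambda>i j a b. (Comp X i j (fst a) (fst b), Comp Y i j (snd a) (snd b)))\<rparr>"

definition omega_submagma :: "('a, 'm) omega_magma_scheme \<Rightarrow> (nat \<Rightarrow> 'a set) \<Rightarrow> bool" where
  "omega_submagma X S \<longleftrightarrow>
     (\<forall>j. S j \<subseteq> Cell X j) \<and>
     (\<forall>j. \<forall>x\<in>S (Suc j). Dom X j x \<in> S j \<and> Cod X j x \<in> S j) \<and>
     (\<forall>j. \<forall>x\<in>S j. Idn X j x \<in> S (Suc j)) \<and>
     (\<forall>i j. \<forall>a\<in>S j. \<forall>b\<in>S j. composable X i j a b \<longrightarrow> Comp X i j a b \<in> S j)"

definition omega_magma_equivalence ::
  "('a, 'm) omega_magma_scheme \<Rightarrow> (nat \<Rightarrow> ('a \<times> 'a) set) \<Rightarrow> bool" where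
  "omega_magma_equivalence M E \<longleftrightarrow>
     omega_submagma (prod_magma M M) E \<and> (\<forall>j. equiv (Cell M j) (E j))"

definition equivalence_magma ::
  "('a, 'm) omega_magma_scheme \<Rightarrow> (nat \<Rightarrow> ('a \<times> 'a) set) \<Rightarrow> ('a \<times> 'a) omega_magma" where
  "equivalence_magma M E = (prod_magma M M)\<lparr>Cell := E\<rparr>"

text \<open>
  \<open>q : B \<rightarrow> Q\<close> is a coequalizer of \<open>f, g : A \<rightarrow> B\<close> in the category of omega magmas.  HOL cannot
  quantify over types inside a formula, so the type of the cells of the test objects is a
  parameter; statements below leave it a free type variable, i.e. arbitrary.
\<close>

definition is_coequalizer ::
  "'z itself \<Rightarrow> 'a omega_magma \<Rightarrow> 'b omega_magma \<Rightarrow> (nat \<Rightarrow> 'a \<Rightarrow> 'b) \<Rightarrow> (nat \<Rightarrow> 'a \<Rightarrow> 'b) \<Rightarrow>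
   'q omega_magma \<Rightarrow> (nat \<Rightarrow> 'b \<Rightarrow> 'q) \<Rightarrow> bool" where
  "is_coequalizer _ A B f g Q q \<longleftrightarrow>
     omega_magma Q \<and> omega_magma_morphism B Q q \<and>
     eq_on_cells A (\<lambda>j x. q j (f j x)) (\<lambda>j x. q j (g j x)) \<and>
     (\<forall>(N :: 'z omega_magma) h.
        omega_magma N \<longrightarrow> omega_magma_morphism B N h \<longrightarrow>
        eq_on_cells A (\<lambda>j x. h j (f j x)) (\<lambda>j x. h j (g j x)) \<longrightarrow>
        (\<exists>k. omega_magma_morphism Q N k \<and> eq_on_cells B (\<lambda>j x. k j (q j x)) h \<and>
           (\<forall>k'. omega_magma_morphism Q N k' \<and> eq_on_cells B (\<lambda>j x. k' j (q j x)) h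
              \<longrightarrow> eq_on_cells Q k' k)))"

text \<open>
  The coequalizer \<open>M//E\<close>, built from the generators \<open>M\<close> by identifying \<open>E\<close>-related cells and
  keeping the composites of \<open>M\<close>.  For general \<open>E\<close> the classes of \<open>E\<close> alone do not suffice: cells
  can become composable in the quotient without having composable representatives.
  Theorem \<open>quotient_magma_is_coequalizer\<close> below is the universal property.
\<close>

definition quotient_rels ::
  "('a, 'm) omega_magma_scheme \<Rightarrow> (nat \<Rightarrow> ('a \<times> 'a) set) \<Rightarrow> nat \<Rightarrow> ('a trm \<times> 'a trm) set" where
  "quotient_rels M E j =
     {(Gen x, Gen y) | x y. (x, y) \<in> E j} \<union>
     {(Cmp i (Gen x) (Gen y), Gen (Comp M i j x y)) | i x y. composable M i j x y}"

definition quotient_magma ::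
  "('a, 'm) omega_magma_scheme \<Rightarrow> (nat \<Rightarrow> ('a \<times> 'a) set) \<Rightarrow> 'a trm set omega_magma"
  (infixl "'/'/\<^sub>\<omega>" 75) where
  "M //\<^sub>\<omega> E = presented (underlying_graph M) (quotient_rels M E)"

definition quotient_map ::
  "('a, 'm) omega_magma_scheme \<Rightarrow> (nat \<Rightarrow> ('a \<times> 'a) set) \<Rightarrow> nat \<Rightarrow> 'a \<Rightarrow> 'a trm set" where
  "quotient_map M E = gen (underlying_graph M) (quotient_rels M E)"

definition categorical ::
  "('a, 'm) omega_magma_scheme \<Rightarrow> (nat \<Rightarrow> ('a \<times> 'a) set) \<Rightarrow> bool" where
  "categorical M E \<longleftrightarrow>
     (\<forall>j. \<forall>u \<in> Cell (free_omega_magma (underlying_graph M)) j.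
          \<forall>v \<in> Cell (free_omega_magma (underlying_graph M)) j.
        canonical_map M j u = canonical_map M j v \<longrightarrow> (counit M j u, counit M j v) \<in> E j)"

definition sharp ::
  "('a, 'm) omega_magma_scheme \<Rightarrow> (nat \<Rightarrow> ('a \<times> 'a) set) \<Rightarrow> bool" where
  "sharp M E \<longleftrightarrow>
     (\<forall>k j. \<forall>a \<in> Cell M j. \<forall>b \<in> Cell M j.
        k < j \<longrightarrow> (cod_to M k j a, dom_to M k j b) \<in> E k \<longrightarrow>
        (\<exists>a' b'. (a, a') \<in> E j \<and> (b, b') \<in> E j \<and> cod_to M k j a' = dom_to M k j b'))"

section \<open>Bridge magmas and categorical Penon morphisms\<close>

definition bridge_relation ::
  "('a, 'm) omega_magma_scheme \<Rightarrow> (nat \<Rightarrow> ('a \<times> 'a \<times> 'a) set) \<Rightarrow> bool" where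
  "bridge_relation X R \<longleftrightarrow>
     (\<forall>i. R i \<subseteq> Cell X i \<times> Cell X i \<times> Cell X (Suc i)) \<and>
     (\<forall>i a b c. (a, b, c) \<in> R i \<longrightarrow> parallel X i a b \<and> Dom X i c = a \<and> Cod X i c = b) \<and>
     (\<forall>i. \<forall>a\<in>Cell X i. (a, a, Idn X i a) \<in> R i) \<and>
     (\<forall>i a b c d. (a, b, c) \<in> R i \<and> (a, b, d) \<in> R i \<longrightarrow> c = d)"

definition bridge_magma ::
  "('a, 'm) omega_magma_scheme \<Rightarrow> (nat \<Rightarrow> ('a \<times> 'a \<times> 'a) set) \<Rightarrow> bool" where
  "bridge_magma X R \<longleftrightarrow> omega_magma X \<and> bridge_relation X R"

definition diagonal_bridge ::
  "('a, 'm) omega_graph_scheme \<Rightarrow> nat \<Rightarrow> ('a \<times> 'a \<times> 'a) set" where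
  "diagonal_bridge X i = {(a, a, Idn X i a) | a. a \<in> Cell X i}"

definition bridge_morphism ::
  "('a, 'm) omega_magma_scheme \<Rightarrow> (nat \<Rightarrow> ('a \<times> 'a \<times> 'a) set) \<Rightarrow>
   ('b, 'n) omega_magma_scheme \<Rightarrow> (nat \<Rightarrow> ('b \<times> 'b \<times> 'b) set) \<Rightarrow> (nat \<Rightarrow> 'a \<Rightarrow> 'b) \<Rightarrow> bool" where
  "bridge_morphism X RX Y RY F \<longleftrightarrow>
     bridge_magma X RX \<and> bridge_magma Y RY \<and> omega_magma_morphism X Y F \<and>
     (\<forall>i a b c. (a, b, c) \<in> RX i \<longrightarrow> (F i a, F i b, F (Suc i) c) \<in> RY i)"

definition categorical_Penon_morphism ::
  "('a, 'm) omega_magma_scheme \<Rightarrow> (nat \<Rightarrow> ('a \<times> 'a \<times> 'a) set) \<Rightarrow>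
   ('b, 'n) omega_magma_scheme \<Rightarrow> (nat \<Rightarrow> ('b \<times> 'b \<times> 'b) set) \<Rightarrow> (nat \<Rightarrow> 'a \<Rightarrow> 'b) \<Rightarrow> bool" where
  "categorical_Penon_morphism X RX Y RY F \<longleftrightarrow>
     bridge_morphism X RX Y RY F \<and>
     strict_omega_category Y \<and> RY = diagonal_bridge Y \<and>
     (\<forall>i a b c. (a, b, c) \<in> RX i \<longrightarrow> F i a = F i b \<and> F (Suc i) c = Idn Y i (F i a)) \<and>
     (\<forall>i. \<forall>a\<in>Cell X i. \<forall>b\<in>Cell X i. parallel X i a b \<and> F i a = F i b \<longrightarrow> (\<exists>c. (a, b, c) \<in> RX i))"

definition witness ::
  "('a, 'm) omega_magma_scheme \<Rightarrow> (nat \<Rightarrow> ('a \<times> 'a) set) \<Rightarrow> (nat \<Rightarrow> ('a \<times> 'a \<times> 'a) set) \<Rightarrow> bool" where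
  "witness M E R \<longleftrightarrow>
     (\<forall>j a b c. (a, b, c) \<in> R j \<longrightarrow>
        (a, b) \<in> E j \<and> (c, Idn M j a) \<in> E (Suc j) \<and> (c, Idn M j b) \<in> E (Suc j)) \<and>
     (\<forall>j a b. parallel M j a b \<and> (a, b) \<in> E j \<longrightarrow> (\<exists>c. (a, b, c) \<in> R j))"

section \<open>Universal properties\<close>

subsection \<open>Iterated maps\<close>

lemma (in globular_set) dom_to_closed: "i \<le> j \<Longrightarrow> x \<in> Cell X j \<Longrightarrow> dom_to X i j x \<in> Cell X i"
  by (induction j arbitrary: x) (auto simp: le_Suc_eq Dom_closed elim: le_SucE)

lemma (in globular_set) cod_to_closed: "i \<le> j \<Longrightarrow> x \<in> Cell X j \<Longrightarrow> cod_to X i j x \<in> Cell X i"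
  by (induction j arbitrary: x) (auto simp: le_Suc_eq Cod_closed elim: le_SucE)

lemma (in globular_set) dom_to_Cod:
  "i < j \<Longrightarrow> x \<in> Cell X (Suc j) \<Longrightarrow> dom_to X i j (Cod X j x) = dom_to X i j (Dom X j x)"
  by (cases j) (auto simp: Dom_Dom)

lemma (in globular_set) cod_to_Dom:
  "i < j \<Longrightarrow> x \<in> Cell X (Suc j) \<Longrightarrow> cod_to X i j (Dom X j x) = cod_to X i j (Cod X j x)"
  by (cases j) (auto simp: Cod_Dom)

lemma dom_to_self [simp]: "dom_to X i i x = x"
  by (cases i) auto

lemma cod_to_self [simp]: "cod_to X i i x = x"
  by (cases i) auto

lemma id_to_self [simp]: "id_to X i i x = x"
  by (cases i) auto

lemma morphism_dom_to:
  "globular_set_morphism X Y F \<Longrightarrow> globular_set X \<Longrightarrow> i \<le> j \<Longrightarrow> x \<in> Cell X j \<Longrightarrow>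
   F i (dom_to X i j x) = dom_to Y i j (F j x)"
proof (induction j arbitrary: x)
  case (Suc j)
  show ?case
  proof (cases "i \<le> j")
    case True
    have "F i (dom_to X i j (Dom X j x)) = dom_to Y i j (F j (Dom X j x))"
      using Suc True by (simp add: globular_set.Dom_closed)
    then show ?thesis using Suc.prems True by (simp add: globular_set_morphism_def)
  next
    case False
    then have "i = Suc j" using Suc.prems by simp
    then show ?thesis by simp
  qed
qed auto

lemma morphism_cod_to:
  "globular_set_morphism X Y F \<Longrightarrow> globular_set X \<Longrightarrow> i \<le> j \<Longrightarrow> x \<in> Cell X j \<Longrightarrow>
   F i (cod_to X i j x) = cod_to Y i j (F j x)"
proof (induction j arbitrary: x)
  case (Suc j)
  show ?case
  proof (cases "i \<le> j")
    case True
    have "F i (cod_to X i j (Cod X j x)) = cod_to Y i j (F j (Cod X j x))"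
      using Suc True by (simp add: globular_set.Cod_closed)
    then show ?thesis using Suc.prems True by (simp add: globular_set_morphism_def)
  next
    case False
    then have "i = Suc j" using Suc.prems by simp
    then show ?thesis by simp
  qed
qed auto

lemma morphism_composable:
  assumes "globular_set_morphism X Y F" "globular_set X" "composable X i j a b"
  shows "composable Y i j (F j a) (F j b)"
proof -
  have c: "i < j" "a \<in> Cell X j" "b \<in> Cell X j" "cod_to X i j a = dom_to X i j b"
    using assms(3) by (simp_all add: composable_def)
  have "F j a \<in> Cell Y j" "F j b \<in> Cell Y j"
    using assms(1) c by (simp_all add: globular_set_morphism_def)
  moreover have "cod_to Y i j (F j a) = dom_to Y i j (F j b)"
    using morphism_cod_to[OF assms(1,2) less_imp_le[OF c(1)] c(2)]
      morphism_dom_to[OF assms(1,2) less_imp_le[OF c(1)] c(3)] c(4) by simp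
  ultimately show ?thesis using c(1) by (simp add: composable_def)
qed

lemma omega_magma_globular: "omega_magma X \<Longrightarrow> globular_set X"
  by (rule omega_graph.axioms(1)[OF omega_magma.axioms(1)])

lemma omega_magma_morphism_comp:
  assumes X: "omega_magma X" and F: "omega_magma_morphism X Y F" and H: "omega_magma_morphism Y Z H"
  shows "omega_magma_morphism X Z (\<lambda>j x. H j (F j x))"
proof -
  have FX: "globular_set_morphism X Y F" and FI: "omega_graph_morphism X Y F"
    using F by (simp_all add: omega_magma_morphism_def omega_graph_morphism_def)
  have HI: "omega_graph_morphism Y Z H"
    using H by (simp add: omega_magma_morphism_def)
  have c: "composable Y i j (F j a) (F j b)" if "composable X i j a b" for i j a b
    by (rule morphism_composable[OF FX omega_magma_globular[OF X] that])
  have "omega_graph_morphism X Z (\<lambda>j x. H j (F j x))"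
    using FI HI unfolding omega_graph_morphism_def globular_set_morphism_def by simp
  moreover have "H j (F j (Comp X i j a b)) = Comp Z i j (H j (F j a)) (H j (F j b))"
    if "composable X i j a b" for i j a b
    using F H c[OF that] that unfolding omega_magma_morphism_def by simp
  ultimately show ?thesis by (simp add: omega_magma_morphism_def)
qed

subsection \<open>Presented magmas are magmas\<close>

lemma cong_refl1: "cong G S j t s \<Longrightarrow> cong G S j t t"
  by (rule cong_trans[OF _ cong_sym])

lemma cls_eqI:
  assumes "cong G S j t s"
  shows "cls G S j t = cls G S j s"
proof -
  have "cong G S j t r \<longleftrightarrow> cong G S j s r" for r
    using cong_trans[OF assms, of r] cong_trans[OF cong_sym[OF assms], of r] by blast
  then show ?thesis unfolding cls_def by blast
qed

lemma cls_self: "cong G S j t t \<Longrightarrow> t \<in> cls G S j t"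
  unfolding cls_def by (rule CollectI)

lemma cls_eq_iff:
  assumes "cong G S j t t"
  shows "cls G S j t = cls G S j s \<longleftrightarrow> cong G S j t s"
proof
  assume "cls G S j t = cls G S j s"
  then have "t \<in> cls G S j s" using cls_self[OF assms] by blast
  then show "cong G S j t s" unfolding cls_def by (blast intro: cong_sym)
qed (rule cls_eqI)

lemma cls_UN:
  assumes "cong G S j t t" "\<And>s. cong G S j t s \<Longrightarrow> f s = f t"
  shows "(\<Union>s\<in>cls G S j t. f s) = f t"
proof -
  have "t \<in> cls G S j t" using assms(1) by (rule cls_self)
  moreover have "\<And>s. s \<in> cls G S j t \<Longrightarrow> f s = f t"
    using assms(2) by (simp add: cls_def)
  ultimately show ?thesis by blast
qed

lemma Cell_presented: "Cell (presented G S) j = {cls G S j t | t. cong G S j t t}"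
  by (simp add: presented_def)

lemma cls_in_Cell [simp]: "cong G S j t t \<Longrightarrow> cls G S j t \<in> Cell (presented G S) j"
  unfolding Cell_presented by blast

lemma Dom_presented:
  assumes "cong G S (Suc j) t t"
  shows "Dom (presented G S) j (cls G S (Suc j) t) = cls G S j (tdom G j t)"
  using cls_UN[OF assms, of "\<lambda>t. cls G S j (tdom G j t)"]
  by (simp add: presented_def cls_eqI cong_dom cong_sym)

lemma Cod_presented:
  assumes "cong G S (Suc j) t t"
  shows "Cod (presented G S) j (cls G S (Suc j) t) = cls G S j (tcod G j t)"
  using cls_UN[OF assms, of "\<lambda>t. cls G S j (tcod G j t)"]
  by (simp add: presented_def cls_eqI cong_cod cong_sym)

lemma Idn_presented:
  assumes "cong G S j t t"
  shows "Idn (presented G S) j (cls G S j t) = cls G S (Suc j) (Unit t)"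
  using cls_UN[OF assms, of "\<lambda>t. cls G S (Suc j) (Unit t)"]
  by (simp add: presented_def cls_eqI cong_unit cong_sym)

lemma dom_to_presented:
  "i \<le> j \<Longrightarrow> cong G S j t t \<Longrightarrow>
   cong G S i (dom_to (trms G) i j t) (dom_to (trms G) i j t) \<and>
   dom_to (presented G S) i j (cls G S j t) = cls G S i (dom_to (trms G) i j t)"
proof (induction j arbitrary: t)
  case (Suc j)
  then show ?case
    by (cases "i \<le> j") (auto simp: Dom_presented trms_def cong_dom le_Suc_eq)
qed auto

lemma cod_to_presented:
  "i \<le> j \<Longrightarrow> cong G S j t t \<Longrightarrow>
   cong G S i (cod_to (trms G) i j t) (cod_to (trms G) i j t) \<and>
   cod_to (presented G S) i j (cls G S j t) = cls G S i (cod_to (trms G) i j t)"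
proof (induction j arbitrary: t)
  case (Suc j)
  then show ?case
    by (cases "i \<le> j") (auto simp: Cod_presented trms_def cong_cod le_Suc_eq)
qed auto

lemma id_to_presented:
  "i \<le> j \<Longrightarrow> cong G S i t t \<Longrightarrow>
   cong G S j (id_to (trms G) i j t) (id_to (trms G) i j t) \<and>
   id_to (presented G S) i j (cls G S i t) = cls G S j (id_to (trms G) i j t)"
proof (induction j)
  case (Suc j)
  then show ?case
    by (cases "i \<le> j") (auto simp: Idn_presented trms_def cong_unit le_Suc_eq)
qed auto

lemma composable_presented:
  assumes "cong G S j t t" "cong G S j s s"
  shows "composable (presented G S) i j (cls G S j t) (cls G S j s) \<longleftrightarrow>
    i < j \<and> cong G S i (cod_to (trms G) i j t) (dom_to (trms G) i j s)"
proof (cases "i < j")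
  case True
  have d: "dom_to (presented G S) i j (cls G S j s) = cls G S i (dom_to (trms G) i j s)"
    using dom_to_presented[of i j G S s] assms(2) True by simp
  have c: "cong G S i (cod_to (trms G) i j t) (cod_to (trms G) i j t)"
    "cod_to (presented G S) i j (cls G S j t) = cls G S i (cod_to (trms G) i j t)"
    using cod_to_presented[of i j G S t] assms(1) True by simp_all
  show ?thesis
    unfolding composable_def c(2) d cls_eq_iff[OF c(1)]
    using assms True by simp
qed (simp add: composable_def)

lemma Comp_presented:
  assumes "cong G S j t t" "cong G S j s s"
    and "composable (presented G S) i j (cls G S j t) (cls G S j s)"
  shows "cong G S j (Cmp i t s) (Cmp i t s)"
    and "Comp (presented G S) i j (cls G S j t) (cls G S j s) = cls G S j (Cmp i t s)"
proof -
  have *: "i < j" "cong G S i (cod_to (trms G) i j t) (dom_to (trms G) i j s)"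
    using assms by (auto simp: composable_presented)
  then show "cong G S j (Cmp i t s) (Cmp i t s)"
    using assms by (auto intro: cong_cmp)
  have "cls G S j (Cmp i t' s') = cls G S j (Cmp i t s)"
    if "cong G S j t t'" "cong G S j s s'" for t' s'
    using cong_cmp[OF *(1) that *(2)] by (simp add: cls_eqI cong_sym)
  then have "(\<Union>t'\<in>cls G S j t. \<Union>s'\<in>cls G S j s. cls G S j (Cmp i t' s')) = cls G S j (Cmp i t s)"
    using assms(1,2) unfolding cls_def by blast
  then show "Comp (presented G S) i j (cls G S j t) (cls G S j s) = cls G S j (Cmp i t s)"
    by (simp add: presented_def)
qed

lemma presented_omega_graph: "omega_graph (presented G S)"
proof
  fix x i assume "x \<in> Cell (presented G S) (Suc i)"
  then obtain t where t: "x = cls G S (Suc i) t" "cong G S (Suc i) t t"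
    by (auto simp: Cell_presented)
  show "Dom (presented G S) i x \<in> Cell (presented G S) i"
    "Cod (presented G S) i x \<in> Cell (presented G S) i"
    using t by (auto simp: Dom_presented Cod_presented cong_dom cong_cod)
next
  fix x i assume "x \<in> Cell (presented G S) (Suc (Suc i))"
  then obtain t where t: "x = cls G S (Suc (Suc i)) t" "cong G S (Suc (Suc i)) t t"
    by (auto simp: Cell_presented)
  show "Dom (presented G S) i (Dom (presented G S) (Suc i) x) =
        Dom (presented G S) i (Cod (presented G S) (Suc i) x)"
    "Cod (presented G S) i (Dom (presented G S) (Suc i) x) =
        Cod (presented G S) i (Cod (presented G S) (Suc i) x)"
    using t by (auto simp: Dom_presented Cod_presented cong_dom cong_cod
        intro!: cls_eqI cong_dom_dom cong_cod_dom)
next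
  fix x i assume "x \<in> Cell (presented G S) i"
  then obtain t where t: "x = cls G S i t" "cong G S i t t"
    by (auto simp: Cell_presented)
  show "Idn (presented G S) i x \<in> Cell (presented G S) (Suc i)"
    "Dom (presented G S) i (Idn (presented G S) i x) = x"
    "Cod (presented G S) i (Idn (presented G S) i x) = x"
    using t by (auto simp: Idn_presented Dom_presented Cod_presented cong_unit)
qed

lemma presented_omega_magma: "omega_magma (presented G S)"
proof -
  let ?P = "presented G S"
  interpret omega_graph ?P by (rule presented_omega_graph)
  have reps: "\<exists>t s. a = cls G S j t \<and> b = cls G S j s \<and> cong G S j t t \<and> cong G S j s s"
    if "composable ?P i j a b" for i j a b
    using that by (auto simp: composable_def Cell_presented)
  show ?thesis
  proof
    fix i j a b assume c: "composable ?P i j a b"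
    then obtain t s where ts: "a = cls G S j t" "b = cls G S j s" "cong G S j t t" "cong G S j s s"
      using reps by blast
    show "Comp ?P i j a b \<in> Cell ?P j"
      using c ts Comp_presented by fastforce
  next
    fix i a b assume c: "composable ?P i (Suc i) a b"
    then obtain t s where ts: "a = cls G S (Suc i) t" "b = cls G S (Suc i) s"
      "cong G S (Suc i) t t" "cong G S (Suc i) s s"
      using reps by blast
    show "Dom ?P i (Comp ?P i (Suc i) a b) = Dom ?P i a"
      "Cod ?P i (Comp ?P i (Suc i) a b) = Cod ?P i b"
      using Comp_presented[OF ts(3,4) c[unfolded ts(1,2)]] ts
      by (simp_all add: Dom_presented Cod_presented)
  next
    fix i j :: nat and a b assume ij: "i < j" and c: "composable ?P i (Suc j) a b"
    then obtain t s where ts: "a = cls G S (Suc j) t" "b = cls G S (Suc j) s"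
      "cong G S (Suc j) t t" "cong G S (Suc j) s s"
      using reps by blast
    note C = Comp_presented[OF ts(3,4) c[unfolded ts(1,2)]]
    have cd: "composable ?P i j (Dom ?P j a) (Dom ?P j b)" "composable ?P i j (Cod ?P j a) (Cod ?P j b)"
      using ij c by (auto simp: composable_def Dom_closed Cod_closed dom_to_Cod cod_to_Dom)
    show "Dom ?P j (Comp ?P i (Suc j) a b) = Comp ?P i j (Dom ?P j a) (Dom ?P j b)"
      using C ts ij cd(1) by (simp add: Dom_presented Comp_presented cong_dom)
    show "Cod ?P j (Comp ?P i (Suc j) a b) = Comp ?P i j (Cod ?P j a) (Cod ?P j b)"
      using C ts ij cd(2) by (simp add: Cod_presented Comp_presented cong_cod)
  qed
qed

lemma gen_morphism: "omega_graph_morphism G (presented G S) (gen G S)"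
  unfolding omega_graph_morphism_def globular_set_morphism_def gen_def
proof (intro conjI allI ballI)
  fix i x assume "x \<in> Cell G (Suc i)"
  then show "cls G S i (Gen (Dom G i x)) = Dom (presented G S) i (cls G S (Suc i) (Gen x))"
    "cls G S i (Gen (Cod G i x)) = Cod (presented G S) i (cls G S (Suc i) (Gen x))"
    by (simp_all add: Dom_presented Cod_presented cong_gen)
next
  fix i x assume x: "x \<in> Cell G i"
  then show "cls G S i (Gen x) \<in> Cell (presented G S) i"
    by (simp add: cong_gen)
  show "cls G S (Suc i) (Gen (Idn G i x)) = Idn (presented G S) i (cls G S i (Gen x))"
    using x cls_eqI[OF cong_gen_unit[OF x]] by (simp add: Idn_presented cong_gen)
qed

lemma strict_presented:
  assumes "\<And>j. strict_rels G j \<subseteq> S j"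
  shows "strict_omega_category (presented G S)"
proof -
  let ?P = "presented G S"
  interpret omega_magma ?P by (rule presented_omega_magma)
  have ax: "cls G S j t = cls G S j s"
    if "strict_axiom G j t s" "cong G S j t t" "cong G S j s s" for j t s
    using that assms by (auto simp: strict_rels_def intro!: cls_eqI cong_rel)
  have reps: "\<exists>t. a = cls G S j t \<and> cong G S j t t" if "a \<in> Cell ?P j" for a j
    using that by (auto simp: Cell_presented)
  have compD: "a \<in> Cell ?P j" "b \<in> Cell ?P j" "i < j" if "composable ?P i j a b" for i j a b
    using that by (auto simp: composable_def)
  show ?thesis
  proof
    fix i j a b c
    assume h: "composable ?P i j a b" "composable ?P i j (Comp ?P i j a b) c"
      "composable ?P i j b c" "composable ?P i j a (Comp ?P i j b c)"
    obtain t where t: "a = cls G S j t" "cong G S j t t" using reps[OF compD(1)[OF h(1)]] by blast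
    obtain s where s: "b = cls G S j s" "cong G S j s s" using reps[OF compD(2)[OF h(1)]] by blast
    obtain r where r: "c = cls G S j r" "cong G S j r r" using reps[OF compD(2)[OF h(3)]] by blast
    note 1 = Comp_presented[OF t(2) s(2) h(1)[unfolded t(1) s(1)]]
    note 2 = Comp_presented[OF s(2) r(2) h(3)[unfolded r(1) s(1)]]
    note 3 = Comp_presented[OF 1(1) r(2) h(2)[unfolded t(1) s(1) r(1) 1(2)]]
    note 4 = Comp_presented[OF t(2) 2(1) h(4)[unfolded t(1) s(1) r(1) 2(2)]]
    show "Comp ?P i j (Comp ?P i j a b) c = Comp ?P i j a (Comp ?P i j b c)"
      unfolding t(1) s(1) r(1) 1(2) 2(2) 3(2) 4(2)
      by (rule ax[OF strict_axiom.intros(1)[OF compD(3)[OF h(1)]] 3(1) 4(1)])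
  next
    fix i j k :: nat and a b c d
    assume ij: "i < j" "j < k"
      and h: "composable ?P j k a b" "composable ?P j k c d"
        "composable ?P i k (Comp ?P j k a b) (Comp ?P j k c d)"
        "composable ?P i k a c" "composable ?P i k b d"
        "composable ?P j k (Comp ?P i k a c) (Comp ?P i k b d)"
    obtain t where t: "a = cls G S k t" "cong G S k t t" using reps[OF compD(1)[OF h(1)]] by blast
    obtain s where s: "b = cls G S k s" "cong G S k s s" using reps[OF compD(2)[OF h(1)]] by blast
    obtain r where r: "c = cls G S k r" "cong G S k r r" using reps[OF compD(1)[OF h(2)]] by blast
    obtain q where q: "d = cls G S k q" "cong G S k q q" using reps[OF compD(2)[OF h(2)]] by blast
    note 1 = Comp_presented[OF t(2) s(2) h(1)[unfolded t(1) s(1)]]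
    note 2 = Comp_presented[OF r(2) q(2) h(2)[unfolded r(1) q(1)]]
    note 3 = Comp_presented[OF 1(1) 2(1) h(3)[unfolded t(1) s(1) r(1) q(1) 1(2) 2(2)]]
    note 4 = Comp_presented[OF t(2) r(2) h(4)[unfolded t(1) r(1)]]
    note 5 = Comp_presented[OF s(2) q(2) h(5)[unfolded s(1) q(1)]]
    note 6 = Comp_presented[OF 4(1) 5(1) h(6)[unfolded t(1) s(1) r(1) q(1) 4(2) 5(2)]]
    show "Comp ?P i k (Comp ?P j k a b) (Comp ?P j k c d) =
          Comp ?P j k (Comp ?P i k a c) (Comp ?P i k b d)"
      unfolding t(1) s(1) r(1) q(1) 1(2) 2(2) 3(2) 4(2) 5(2) 6(2)
      by (rule ax[OF strict_axiom.intros(2)[OF ij] 3(1) 6(1)])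
  next
    fix i j :: nat and a assume ij: "i < j" and a: "a \<in> Cell ?P j"
    obtain t where t: "a = cls G S j t" "cong G S j t t" using a reps by blast
    have dom_id: "dom_to ?P i j (id_to ?P i j x) = x \<and> cod_to ?P i j (id_to ?P i j x) = x \<and>
        id_to ?P i j x \<in> Cell ?P j"
      if "i \<le> j" "x \<in> Cell ?P i" for x i j
      using that
      by (induction j) (auto simp: le_Suc_eq Dom_Idn Cod_Idn Idn_closed)
    let ?d = "id_to (trms G) i j (dom_to (trms G) i j t)"
    let ?c = "id_to (trms G) i j (cod_to (trms G) i j t)"
    have d: "cong G S j ?d ?d" "cls G S j ?d = id_to ?P i j (dom_to ?P i j a)"
      using t ij dom_to_presented[of i j G S t] id_to_presented[of i j G S "dom_to (trms G) i j t"]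
      by auto
    have c: "cong G S j ?c ?c" "cls G S j ?c = id_to ?P i j (cod_to ?P i j a)"
      using t ij cod_to_presented[of i j G S t] id_to_presented[of i j G S "cod_to (trms G) i j t"]
      by auto
    have cd: "composable ?P i j (cls G S j ?d) a" "composable ?P i j a (cls G S j ?c)"
      using dom_id[of i j] a ij dom_to_closed cod_to_closed by (auto simp: composable_def d c)
    note 1 = Comp_presented[OF d(1) t(2) cd(1)[unfolded t(1)]]
    note 2 = Comp_presented[OF t(2) c(1) cd(2)[unfolded t(1)]]
    show "Comp ?P i j (id_to ?P i j (dom_to ?P i j a)) a = a"
      unfolding d(2)[symmetric] unfolding t(1) 1(2)
      by (rule ax[OF strict_axiom.intros(3)[OF ij] 1(1) t(2)])
    show "Comp ?P i j a (id_to ?P i j (cod_to ?P i j a)) = a"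
      unfolding c(2)[symmetric] unfolding t(1) 2(2)
      by (rule ax[OF strict_axiom.intros(4)[OF ij] 2(1) t(2)])
  next
    fix i j a b assume h: "composable ?P i j a b"
    obtain t where t: "a = cls G S j t" "cong G S j t t" using reps[OF compD(1)[OF h]] by blast
    obtain s where s: "b = cls G S j s" "cong G S j s s" using reps[OF compD(2)[OF h]] by blast
    note 1 = Comp_presented[OF t(2) s(2) h[unfolded t(1) s(1)]]
    have "composable ?P i (Suc j) (Idn ?P j a) (Idn ?P j b)"
      using h by (auto simp: composable_def Idn_closed Dom_Idn Cod_Idn)
    then have u: "composable ?P i (Suc j) (cls G S (Suc j) (Unit t)) (cls G S (Suc j) (Unit s))"
      by (simp add: t s Idn_presented)
    note 2 = Comp_presented[OF cong_unit[OF t(2)] cong_unit[OF s(2)] u]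
    show "Comp ?P i (Suc j) (Idn ?P j a) (Idn ?P j b) = Idn ?P j (Comp ?P i j a b)"
      unfolding t(1) s(1) Idn_presented[OF t(2)] Idn_presented[OF s(2)] 1(2) 2(2)
        Idn_presented[OF 1(1)]
      by (rule ax[OF strict_axiom.intros(5)[OF compD(3)[OF h]] 2(1) cong_unit[OF 1(1)]])
  qed
qed

subsection \<open>Soundness of evaluation\<close>

primrec wd ::
  "('a, 'm) omega_graph_scheme \<Rightarrow> ('b, 'n) omega_magma_scheme \<Rightarrow> (nat \<Rightarrow> 'a \<Rightarrow> 'b) \<Rightarrow>
   nat \<Rightarrow> 'a trm \<Rightarrow> bool" where
  "wd G N f j (Gen x) \<longleftrightarrow> x \<in> Cell G j"
| "wd G N f j (Unit t) \<longleftrightarrow> 0 < j \<and> wd G N f (j - 1) t"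
| "wd G N f j (Cmp i t s) \<longleftrightarrow>
     wd G N f j t \<and> wd G N f j s \<and> composable N i j (eval N f j t) (eval N f j s)"

definition resp_rels ::
  "('a, 'm) omega_graph_scheme \<Rightarrow> (nat \<Rightarrow> ('a trm \<times> 'a trm) set) \<Rightarrow> ('b, 'n) omega_magma_scheme \<Rightarrow>
   (nat \<Rightarrow> 'a \<Rightarrow> 'b) \<Rightarrow> bool" where
  "resp_rels G S N f \<longleftrightarrow>
     (\<forall>j t s. (t, s) \<in> S j \<and> wd G N f j t \<and> wd G N f j s \<longrightarrow> eval N f j t = eval N f j s)"

locale interpretation_of_graph =
  G: omega_graph G + N: omega_magma N
  for G :: "('a, 'm) omega_graph_scheme" and N :: "('b, 'n) omega_magma_scheme" +
  fixes f :: "nat \<Rightarrow> 'a \<Rightarrow> 'b"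
  assumes f: "omega_graph_morphism G N f"
begin

lemma eval_closed: "wd G N f j t \<Longrightarrow> eval N f j t \<in> Cell N j"
proof (induction t arbitrary: j)
  case (Gen x)
  then show ?case using f by (auto simp: omega_graph_morphism_def globular_set_morphism_def)
next
  case (Unit t)
  then show ?case using N.Idn_closed by (cases j) auto
next
  case (Cmp i t s)
  then show ?case using N.Comp_closed by auto
qed

lemma composable_faces:
  assumes "i < j" "composable N i (Suc j) a b"
  shows "composable N i j (Dom N j a) (Dom N j b)" "composable N i j (Cod N j a) (Cod N j b)"
  using assms
  by (auto simp: composable_def N.Dom_closed N.Cod_closed N.dom_to_Cod N.cod_to_Dom)

lemma composable_less: "composable N i (Suc j) a b \<Longrightarrow> i \<noteq> j \<Longrightarrow> i < j"
  by (auto simp: composable_def)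

lemma wd_tdom:
  "wd G N f (Suc j) t \<Longrightarrow>
   wd G N f j (tdom G j t) \<and> eval N f j (tdom G j t) = Dom N j (eval N f (Suc j) t)"
proof (induction t)
  case (Gen x)
  then show ?case
    using f by (auto simp: omega_graph_morphism_def globular_set_morphism_def G.Dom_closed)
next
  case (Unit t)
  then show ?case using eval_closed by (auto simp: N.Dom_Idn)
next
  case (Cmp i t s)
  then have c: "composable N i (Suc j) (eval N f (Suc j) t) (eval N f (Suc j) s)" by simp
  show ?case
  proof (cases "i = j")
    case True
    then show ?thesis using Cmp c by (auto simp: N.Dom_Comp)
  next
    case False
    with c have "i < j" by (simp add: composable_less)
    then show ?thesis using Cmp c False composable_faces(1)[OF _ c] by (auto simp: N.Dom_Comp')
  qed
qed

lemma wd_tcod: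
  "wd G N f (Suc j) t \<Longrightarrow>
   wd G N f j (tcod G j t) \<and> eval N f j (tcod G j t) = Cod N j (eval N f (Suc j) t)"
proof (induction t)
  case (Gen x)
  then show ?case
    using f by (auto simp: omega_graph_morphism_def globular_set_morphism_def G.Cod_closed)
next
  case (Unit t)
  then show ?case using eval_closed by (auto simp: N.Cod_Idn)
next
  case (Cmp i t s)
  then have c: "composable N i (Suc j) (eval N f (Suc j) t) (eval N f (Suc j) s)" by simp
  show ?case
  proof (cases "i = j")
    case True
    then show ?thesis using Cmp c by (auto simp: N.Cod_Comp)
  next
    case False
    with c have "i < j" by (simp add: composable_less)
    then show ?thesis using Cmp c False composable_faces(2)[OF _ c] by (auto simp: N.Cod_Comp')
  qed
qed

lemma wd_dom_to:
  "i \<le> j \<Longrightarrow> wd G N f j t \<Longrightarrow> wd G N f i (dom_to (trms G) i j t) \<and>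
   eval N f i (dom_to (trms G) i j t) = dom_to N i j (eval N f j t)"
proof (induction j arbitrary: t)
  case (Suc j)
  then show ?case
    by (cases "i \<le> j") (auto simp: wd_tdom trms_def le_Suc_eq)
qed auto

lemma wd_cod_to:
  "i \<le> j \<Longrightarrow> wd G N f j t \<Longrightarrow> wd G N f i (cod_to (trms G) i j t) \<and>
   eval N f i (cod_to (trms G) i j t) = cod_to N i j (eval N f j t)"
proof (induction j arbitrary: t)
  case (Suc j)
  then show ?case
    by (cases "i \<le> j") (auto simp: wd_tcod trms_def le_Suc_eq)
qed auto

lemma wd_id_to:
  "i \<le> j \<Longrightarrow> wd G N f i t \<Longrightarrow> wd G N f j (id_to (trms G) i j t) \<and>
   eval N f j (id_to (trms G) i j t) = id_to N i j (eval N f i t)"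
proof (induction j)
  case (Suc j)
  then show ?case
    by (cases "i \<le> j") (auto simp: trms_def le_Suc_eq)
qed auto

lemma sound:
  assumes "resp_rels G S N f"
  shows "cong G S j t s \<Longrightarrow> wd G N f j t \<and> wd G N f j s \<and> eval N f j t = eval N f j s"
proof (induction rule: cong.induct)
  case (cong_dom j t s)
  then show ?case using wd_tdom by auto
next
  case (cong_cod j t s)
  then show ?case using wd_tcod by auto
next
  case (cong_dom_dom j t)
  then have t: "wd G N f (Suc (Suc j)) t" by blast
  show ?case
    using wd_tdom[OF t] wd_tcod[OF t] wd_tdom[of j "tdom G (Suc j) t"] wd_tdom[of j "tcod G (Suc j) t"]
      N.Dom_Dom[OF eval_closed[OF t]] by simp
next
  case (cong_cod_dom j t)
  then have t: "wd G N f (Suc (Suc j)) t" by blast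
  show ?case
    using wd_tdom[OF t] wd_tcod[OF t] wd_tcod[of j "tdom G (Suc j) t"] wd_tcod[of j "tcod G (Suc j) t"]
      N.Cod_Dom[OF eval_closed[OF t]] by simp
next
  case (cong_gen_unit x j)
  then show ?case using f by (auto simp: omega_graph_morphism_def G.Idn_closed)
next
  case (cong_cmp i j t t' s s')
  then have "composable N i j (eval N f j t) (eval N f j s)"
    using wd_dom_to[of i j s] wd_cod_to[of i j t] eval_closed by (auto simp: composable_def)
  then show ?case using cong_cmp by auto
next
  case (cong_rel t s j)
  then show ?case using assms unfolding resp_rels_def by blast
qed auto

lemma extend_cls:
  assumes "resp_rels G S N f" "cong G S j t t"
  shows "extend_map N f j (cls G S j t) = eval N f j t"
proof -
  have "(SOME s. s \<in> cls G S j t) \<in> cls G S j t"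
    using cls_self[OF assms(2)] by (rule someI)
  then have "cong G S j t (SOME s. s \<in> cls G S j t)" by (simp add: cls_def)
  from sound[OF assms(1) this] show ?thesis unfolding extend_map_def by simp
qed

lemma extend_gen:
  assumes "resp_rels G S N f"
  shows "eq_on_cells G (\<lambda>j x. extend_map N f j (gen G S j x)) f"
  by (simp add: eq_on_cells_def gen_def extend_cls[OF assms] cong_gen)

lemma extend_morphism:
  assumes "resp_rels G S N f"
  shows "omega_magma_morphism (presented G S) N (extend_map N f)"
proof -
  note ext = extend_cls[OF assms] and snd = sound[OF assms]
  show ?thesis
    unfolding omega_magma_morphism_def omega_graph_morphism_def globular_set_morphism_def
  proof (intro conjI allI ballI impI)
    fix i A assume "A \<in> Cell (presented G S) i"
    then obtain t where t: "A = cls G S i t" "cong G S i t t" by (auto simp: Cell_presented)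
    have "wd G N f i t" using snd[OF t(2)] by blast
    then show "extend_map N f i A \<in> Cell N i"
      unfolding t(1) ext[OF t(2)] by (rule eval_closed)
    show "extend_map N f (Suc i) (Idn (presented G S) i A) = Idn N i (extend_map N f i A)"
      using t by (simp add: ext Idn_presented cong_unit)
  next
    fix i A assume "A \<in> Cell (presented G S) (Suc i)"
    then obtain t where t: "A = cls G S (Suc i) t" "cong G S (Suc i) t t"
      by (auto simp: Cell_presented)
    then have "wd G N f (Suc i) t" using snd by blast
    then show "extend_map N f i (Dom (presented G S) i A) = Dom N i (extend_map N f (Suc i) A)"
      "extend_map N f i (Cod (presented G S) i A) = Cod N i (extend_map N f (Suc i) A)"
      using t wd_tdom wd_tcod by (simp_all add: ext Dom_presented Cod_presented cong_dom cong_cod)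
  next
    fix i j A B assume c: "composable (presented G S) i j A B"
    then obtain t s where t: "A = cls G S j t" "cong G S j t t"
      and s: "B = cls G S j s" "cong G S j s s"
      by (auto simp: Cell_presented composable_def)
    note 1 = Comp_presented[OF t(2) s(2) c[unfolded t(1) s(1)]]
    show "extend_map N f j (Comp (presented G S) i j A B) =
          Comp N i j (extend_map N f j A) (extend_map N f j B)"
      by (simp add: t s 1 ext)
  qed
qed

lemma extend_unique:
  assumes "resp_rels G S N f" "omega_magma_morphism (presented G S) N h"
    and "eq_on_cells G (\<lambda>j x. h j (gen G S j x)) f"
  shows "eq_on_cells (presented G S) h (extend_map N f)"
proof -
  let ?P = "presented G S"
  have h: "\<And>i A. A \<in> Cell ?P (Suc i) \<Longrightarrow> h i (Dom ?P i A) = Dom N i (h (Suc i) A)"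
    "\<And>i A. A \<in> Cell ?P (Suc i) \<Longrightarrow> h i (Cod ?P i A) = Cod N i (h (Suc i) A)"
    "\<And>i A. A \<in> Cell ?P i \<Longrightarrow> h (Suc i) (Idn ?P i A) = Idn N i (h i A)"
    "\<And>i j A B. composable ?P i j A B \<Longrightarrow> h j (Comp ?P i j A B) = Comp N i j (h j A) (h j B)"
    using assms(2)
    unfolding omega_magma_morphism_def omega_graph_morphism_def globular_set_morphism_def by blast+
  note snd = sound[OF assms(1)]
  have hg: "h j (cls G S j (Gen x)) = f j x" if "x \<in> Cell G j" for j x
    using assms(3) that by (auto simp: eq_on_cells_def gen_def)
  have hd: "h j (cls G S j (tdom G j t)) = eval N f j (tdom G j t)"
    if "cong G S (Suc j) t t" "h (Suc j) (cls G S (Suc j) t) = eval N f (Suc j) t" for j t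
    using h(1)[OF cls_in_Cell[OF that(1)]] that(2) wd_tdom[of j t] snd[OF that(1)]
    by (simp add: Dom_presented[OF that(1)])
  have hc: "h j (cls G S j (tcod G j t)) = eval N f j (tcod G j t)"
    if "cong G S (Suc j) t t" "h (Suc j) (cls G S (Suc j) t) = eval N f (Suc j) t" for j t
    using h(2)[OF cls_in_Cell[OF that(1)]] that(2) wd_tcod[of j t] snd[OF that(1)]
    by (simp add: Cod_presented[OF that(1)])
  have "h j (cls G S j t) = eval N f j t" if "cong G S j t s" for j t s
    using that
  proof (induction rule: cong.induct)
    case (cong_gen x j)
    then show ?case by (simp add: hg)
  next
    case (cong_sym j t s)
    then show ?case using cls_eqI[OF cong_sym.hyps] snd[OF cong_sym.hyps] by simp
  next
    case (cong_dom j t s)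
    show ?case by (rule hd[OF cong_refl1[OF cong_dom.hyps] cong_dom.IH])
  next
    case (cong_cod j t s)
    show ?case by (rule hc[OF cong_refl1[OF cong_cod.hyps] cong_cod.IH])
  next
    case (cong_dom_dom j t)
    show ?case
      by (rule hd[OF cong.cong_dom[OF cong_dom_dom.hyps] hd[OF cong_dom_dom.hyps cong_dom_dom.IH]])
  next
    case (cong_cod_dom j t)
    show ?case
      by (rule hc[OF cong.cong_dom[OF cong_cod_dom.hyps] hd[OF cong_cod_dom.hyps cong_cod_dom.IH]])
  next
    case (cong_unit j t s)
    have t: "cong G S j t t" by (rule cong_refl1[OF cong_unit.hyps])
    show ?case using h(3)[OF cls_in_Cell[OF t]] cong_unit.IH by (simp add: Idn_presented[OF t])
  next
    case (cong_gen_unit x j)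
    have t: "cong G S j (Gen x) (Gen x)" by (rule cong.cong_gen[OF cong_gen_unit.hyps])
    show ?case
      using h(3)[OF cls_in_Cell[OF t]] hg[OF cong_gen_unit.hyps] by (simp add: Idn_presented[OF t])
  next
    case (cong_cmp i j t t' s s')
    have ts: "cong G S j t t" "cong G S j s s"
      using cong_refl1[OF cong_cmp.hyps(2)] cong_refl1[OF cong_cmp.hyps(3)] by simp_all
    have c: "composable ?P i j (cls G S j t) (cls G S j s)"
      unfolding composable_presented[OF ts] using cong_cmp.hyps by simp
    show ?case
      using h(4)[OF c] Comp_presented(2)[OF ts c] cong_cmp.IH by simp
  next
    case (cong_trans j t s r)
    then show ?case by simp
  next
    case (cong_rel t s j)
    then show ?case by simp
  qed
  then show ?thesis
    by (auto simp: eq_on_cells_def Cell_presented extend_cls[OF assms(1)])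
qed

end

lemma underlying_graph_simps [simp]:
  "Cell (underlying_graph M) = Cell M" "Dom (underlying_graph M) = Dom M"
  "Cod (underlying_graph M) = Cod M" "Idn (underlying_graph M) = Idn M"
  by (simp_all add: underlying_graph_def)

lemma underlying_graph_omega_graph: "omega_magma M \<Longrightarrow> omega_graph (underlying_graph M)"
  using omega_magma.axioms(1)
  by (fastforce simp: omega_graph_def omega_graph_axioms_def globular_set_def)

lemma underlying_graph_morphism [simp]:
  "omega_graph_morphism (underlying_graph M) N f \<longleftrightarrow> omega_graph_morphism M N f"
  by (simp add: omega_graph_morphism_def globular_set_morphism_def)

subsection \<open>The free omega magma\<close>

theorem free_omega_magma_universal:
  fixes N :: "'b omega_magma"
  assumes "omega_graph G" "omega_magma N" "omega_graph_morphism G N f"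
  shows "omega_magma (free_omega_magma G)"
    and "omega_graph_morphism G (free_omega_magma G) (gen G (\<lambda>_. {}))"
    and "omega_magma_morphism (free_omega_magma G) N (extend_map N f)"
    and "eq_on_cells G (\<lambda>j x. extend_map N f j (gen G (\<lambda>_. {}) j x)) f"
    and "omega_magma_morphism (free_omega_magma G) N h \<Longrightarrow>
         eq_on_cells G (\<lambda>j x. h j (gen G (\<lambda>_. {}) j x)) f \<Longrightarrow>
         eq_on_cells (free_omega_magma G) h (extend_map N f)"
proof -
  interpret interpretation_of_graph G N f
    using assms by (simp add: interpretation_of_graph_def interpretation_of_graph_axioms_def)
  have r: "resp_rels G (\<lambda>_. {}) N f" by (simp add: resp_rels_def)
  show "omega_magma (free_omega_magma G)"
    by (simp add: free_omega_magma_def presented_omega_magma)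
  show "omega_graph_morphism G (free_omega_magma G) (gen G (\<lambda>_. {}))"
    by (simp add: free_omega_magma_def gen_morphism)
  show "omega_magma_morphism (free_omega_magma G) N (extend_map N f)"
    "eq_on_cells G (\<lambda>j x. extend_map N f j (gen G (\<lambda>_. {}) j x)) f"
    by (simp_all add: free_omega_magma_def extend_morphism[OF r] extend_gen[OF r])
  show "omega_magma_morphism (free_omega_magma G) N h \<Longrightarrow>
         eq_on_cells G (\<lambda>j x. h j (gen G (\<lambda>_. {}) j x)) f \<Longrightarrow>
         eq_on_cells (free_omega_magma G) h (extend_map N f)"
    by (simp add: free_omega_magma_def extend_unique[OF r])
qed

text \<open>\<open>counit M\<close> is the morphism \<open>L(UM) \<rightarrow> M\<close> that is the identity on generators.\<close>

lemma counit_morphism: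
  fixes M :: "'a omega_magma"
  assumes "omega_magma M"
  shows "omega_magma_morphism (free_omega_magma (underlying_graph M)) M (counit M)"
    and "x \<in> Cell M j \<Longrightarrow> counit M j (gen (underlying_graph M) (\<lambda>_. {}) j x) = x"
proof -
  have "omega_graph_morphism (underlying_graph M) M (\<lambda>_ x. x)"
    by (simp add: omega_graph_morphism_def globular_set_morphism_def)
  note u = free_omega_magma_universal[OF underlying_graph_omega_graph[OF assms] assms this]
  show "omega_magma_morphism (free_omega_magma (underlying_graph M)) M (counit M)"
    "x \<in> Cell M j \<Longrightarrow> counit M j (gen (underlying_graph M) (\<lambda>_. {}) j x) = x"
    using u(3,4) by (auto simp: counit_def eq_on_cells_def)
qed

subsection \<open>The free strict omega category\<close>

lemma resp_rels_strict:
  assumes "interpretation_of_graph G N f" "strict_omega_category N"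
  shows "resp_rels G (strict_rels G) N f"
proof -
  interpret interpretation_of_graph G N f by fact
  interpret S: strict_omega_category N by fact
  have "eval N f j t = eval N f j s"
    if ax: "strict_axiom G j t s" and w: "wd G N f j t" "wd G N f j s" for j t s
    using ax
  proof cases
    case (1 i a b c)
    show ?thesis
      using w unfolding 1 eval.simps wd.simps by (elim conjE) (rule S.assoc)
  next
    case (2 i k a b c d)
    show ?thesis
      using w unfolding 2 eval.simps wd.simps by (elim conjE) (rule S.interchange[OF 2(3,4)])
  next
    case (3 i)
    have "wd G N f i (dom_to (trms G) i j s)"
      "eval N f i (dom_to (trms G) i j s) = dom_to N i j (eval N f j s)"
      using wd_dom_to[of i j s] w(2) 3 by simp_all
    then have "eval N f j (id_to (trms G) i j (dom_to (trms G) i j s)) =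
        id_to N i j (dom_to N i j (eval N f j s))"
      using wd_id_to[of i j "dom_to (trms G) i j s"] 3 by simp
    then show ?thesis
      using S.id_left[OF 3(2) eval_closed[OF w(2)]] unfolding 3(1) by simp
  next
    case (4 i)
    have "wd G N f i (cod_to (trms G) i j s)"
      "eval N f i (cod_to (trms G) i j s) = cod_to N i j (eval N f j s)"
      using wd_cod_to[of i j s] w(2) 4 by simp_all
    then have "eval N f j (id_to (trms G) i j (cod_to (trms G) i j s)) =
        id_to N i j (cod_to N i j (eval N f j s))"
      using wd_id_to[of i j "cod_to (trms G) i j s"] 4 by simp
    then show ?thesis
      using S.id_right[OF 4(2) eval_closed[OF w(2)]] unfolding 4(1) by simp
  next
    case (5 i k a b)
    then have "composable N i k (eval N f k a) (eval N f k b)"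
      using w(2) by simp
    then show ?thesis using S.Idn_Comp unfolding 5 by simp
  qed
  then show ?thesis by (auto simp: resp_rels_def strict_rels_def)
qed

theorem free_strict_category_universal:
  fixes N :: "'b omega_magma"
  assumes "omega_graph G" "strict_omega_category N" "omega_graph_morphism G N f"
  shows "strict_omega_category (free_strict_category G)"
    and "omega_graph_morphism G (free_strict_category G) (gen G (strict_rels G))"
    and "omega_magma_morphism (free_strict_category G) N (extend_map N f)"
    and "eq_on_cells G (\<lambda>j x. extend_map N f j (gen G (strict_rels G) j x)) f"
    and "omega_magma_morphism (free_strict_category G) N h \<Longrightarrow>
         eq_on_cells G (\<lambda>j x. h j (gen G (strict_rels G) j x)) f \<Longrightarrow>
         eq_on_cells (free_strict_category G) h (extend_map N f)"
proof -
  interpret interpretation_of_graph G N f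
    using assms
    by (simp add: interpretation_of_graph_def interpretation_of_graph_axioms_def
        strict_omega_category.axioms(1))
  have r: "resp_rels G (strict_rels G) N f"
    by (rule resp_rels_strict[OF _ assms(2)]) (unfold_locales)
  show "strict_omega_category (free_strict_category G)"
    by (simp add: free_strict_category_def strict_presented)
  show "omega_graph_morphism G (free_strict_category G) (gen G (strict_rels G))"
    by (simp add: free_strict_category_def gen_morphism)
  show "omega_magma_morphism (free_strict_category G) N (extend_map N f)"
    "eq_on_cells G (\<lambda>j x. extend_map N f j (gen G (strict_rels G) j x)) f"
    by (simp_all add: free_strict_category_def extend_morphism[OF r] extend_gen[OF r])
  show "omega_magma_morphism (free_strict_category G) N h \<Longrightarrow>
         eq_on_cells G (\<lambda>j x. h j (gen G (strict_rels G) j x)) f \<Longrightarrow>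
         eq_on_cells (free_strict_category G) h (extend_map N f)"
    by (simp add: free_strict_category_def extend_unique[OF r])
qed

lemma canonical_map_morphism:
  fixes M :: "'a omega_magma"
  assumes "omega_magma M"
  defines "G \<equiv> underlying_graph M"
  shows "omega_magma_morphism (free_omega_magma G) (free_strict_category G) (canonical_map M)"
    and "x \<in> Cell M j \<Longrightarrow> canonical_map M j (gen G (\<lambda>_. {}) j x) = gen G (strict_rels G) j x"
proof -
  have "omega_magma (free_strict_category G)"
    "omega_graph_morphism G (free_strict_category G) (gen G (strict_rels G))"
    by (simp_all add: free_strict_category_def presented_omega_magma gen_morphism)
  note u = free_omega_magma_universal
    [OF underlying_graph_omega_graph[OF assms(1), folded G_def] this]
  show "omega_magma_morphism (free_omega_magma G) (free_strict_category G) (canonical_map M)"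
    "x \<in> Cell M j \<Longrightarrow> canonical_map M j (gen G (\<lambda>_. {}) j x) = gen G (strict_rels G) j x"
    using u(3,4) by (auto simp: canonical_map_def eq_on_cells_def G_def)
qed

text \<open>
  \<open>canonical_map M\<close> is the unit at \<open>L(UM)\<close> of the adjunction between strict omega categories and
  omega magmas: it is universal among omega magma morphisms from \<open>L(UM)\<close> to strict omega categories.
\<close>

theorem canonical_map_universal:
  fixes M :: "'a omega_magma" and N :: "'b omega_magma"
  assumes M: "omega_magma M" and N: "strict_omega_category N"
  defines "G \<equiv> underlying_graph M"
  assumes h: "omega_magma_morphism (free_omega_magma G) N h"
  shows "\<exists>k. omega_magma_morphism (free_strict_category G) N k \<and>
             eq_on_cells (free_omega_magma G) (\<lambda>j u. k j (canonical_map M j u)) h \<and>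
             (\<forall>k'. omega_magma_morphism (free_strict_category G) N k' \<and>
                   eq_on_cells (free_omega_magma G) (\<lambda>j u. k' j (canonical_map M j u)) h
                \<longrightarrow> eq_on_cells (free_strict_category G) k' k)"
proof -
  let ?L = "free_omega_magma G" and ?C = "free_strict_category G"
  let ?l = "gen G (\<lambda>_. {})" and ?c = "gen G (strict_rels G)"
  have Nm: "omega_magma N" using N by (rule strict_omega_category.axioms(1))
  have G: "omega_graph G" unfolding G_def by (rule underlying_graph_omega_graph[OF M])
  have L: "omega_magma ?L" by (simp add: free_omega_magma_def presented_omega_magma)
  have l: "omega_graph_morphism G ?L ?l" by (simp add: free_omega_magma_def gen_morphism)
  have lC: "?l j x \<in> Cell ?L j" if "x \<in> Cell G j" for j x
    using l that by (auto simp: omega_graph_morphism_def globular_set_morphism_def)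
  have f: "omega_graph_morphism G N (\<lambda>j x. h j (?l j x))"
    using l h
    unfolding omega_magma_morphism_def omega_graph_morphism_def globular_set_morphism_def by simp
  note uC = free_strict_category_universal[OF G N f]
  note uL = free_omega_magma_universal[OF G Nm f]
  note cm = canonical_map_morphism[OF M, folded G_def]
  have cg: "canonical_map M j (?l j x) = ?c j x" if "x \<in> Cell G j" for j x
    using cm(2) that by (simp add: G_def)
  define k where "k = extend_map N (\<lambda>j x. h j (?l j x))"
  have k: "omega_magma_morphism ?C N k" unfolding k_def by (rule uC(3))
  have "eq_on_cells G (\<lambda>j x. k j (canonical_map M j (?l j x))) (\<lambda>j x. h j (?l j x))"
    using uC(4) by (simp add: eq_on_cells_def cg k_def)
  then have "eq_on_cells ?L (\<lambda>j u. k j (canonical_map M j u)) (extend_map N (\<lambda>j x. h j (?l j x)))"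
    by (rule uL(5)[OF omega_magma_morphism_comp[OF L cm(1) k]])
  moreover have "eq_on_cells ?L h (extend_map N (\<lambda>j x. h j (?l j x)))"
    by (rule uL(5)[OF h]) (simp add: eq_on_cells_def)
  ultimately have kh: "eq_on_cells ?L (\<lambda>j u. k j (canonical_map M j u)) h"
    by (simp add: eq_on_cells_def)
  have "eq_on_cells ?C k' k" if k': "omega_magma_morphism ?C N k'"
    "eq_on_cells ?L (\<lambda>j u. k' j (canonical_map M j u)) h" for k'
    unfolding k_def
  proof (rule uC(5)[OF k'(1)])
    show "eq_on_cells G (\<lambda>j x. k' j (?c j x)) (\<lambda>j x. h j (?l j x))"
      using k'(2) lC cg unfolding eq_on_cells_def by metis
  qed
  with k kh show ?thesis by blast
qed

subsection \<open>The quotient is the coequalizer\<close>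

theorem quotient_magma_is_coequalizer:
  fixes M :: "'a omega_magma"
  assumes M: "omega_magma M" and E: "omega_magma_equivalence M E"
  shows "is_coequalizer TYPE('z) (equivalence_magma M E) M (\<lambda>_. fst) (\<lambda>_. snd)
           (M //\<^sub>\<omega> E) (quotient_map M E)"
proof -
  let ?G = "underlying_graph M" and ?S = "quotient_rels M E"
  let ?Q = "M //\<^sub>\<omega> E" and ?q = "quotient_map M E"
  interpret M: omega_magma M by (rule M)
  have Q: "omega_magma ?Q"
    by (simp add: quotient_magma_def presented_omega_magma)
  have qg: "omega_graph_morphism M ?Q ?q"
    using gen_morphism[of ?G ?S] by (simp add: quotient_magma_def quotient_map_def)
  have EC: "x \<in> Cell M j \<and> y \<in> Cell M j" if "(x, y) \<in> E j" for x y j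
  proof -
    have "E j \<subseteq> Cell M j \<times> Cell M j"
      using E unfolding omega_magma_equivalence_def equiv_def by blast
    then show ?thesis using that by blast
  qed
  have qE: "?q j x = ?q j y" if "(x, y) \<in> E j" for j x y
  proof -
    have "cong ?G ?S j (Gen x) (Gen y)"
      by (rule cong_rel) (use that EC[OF that] in \<open>simp_all add: quotient_rels_def cong_gen\<close>)
    then show ?thesis by (simp add: quotient_map_def gen_def cls_eqI)
  qed
  have qC: "?q j (Comp M i j x y) = Comp ?Q i j (?q j x) (?q j y)" if c: "composable M i j x y" for i j x y
  proof -
    have xy: "cong ?G ?S j (Gen x) (Gen x)" "cong ?G ?S j (Gen y) (Gen y)"
      using c by (auto simp: composable_def intro!: cong_gen)
    have "composable ?Q i j (?q j x) (?q j y)"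
      by (rule morphism_composable[OF _ omega_magma_globular[OF M] c])
        (use qg in \<open>simp add: omega_graph_morphism_def\<close>)
    note 1 = Comp_presented[OF xy, of i]
    have 2: "composable (presented ?G ?S) i j (cls ?G ?S j (Gen x)) (cls ?G ?S j (Gen y))"
      using \<open>composable ?Q i j (?q j x) (?q j y)\<close>
      by (simp add: quotient_magma_def quotient_map_def gen_def)
    have "cong ?G ?S j (Cmp i (Gen x) (Gen y)) (Gen (Comp M i j x y))"
    proof (rule cong_rel)
      show "(Cmp i (Gen x) (Gen y), Gen (Comp M i j x y)) \<in> ?S j"
        using c unfolding quotient_rels_def by blast
      show "cong ?G ?S j (Gen (Comp M i j x y)) (Gen (Comp M i j x y))"
        using M.Comp_closed[OF c] by (simp add: cong_gen)
    qed (rule 1(1)[OF 2])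
    then show ?thesis
      using 1(2)[OF 2] by (simp add: quotient_magma_def quotient_map_def gen_def cls_eqI)
  qed
  have q: "omega_magma_morphism M ?Q ?q"
    using qg qC by (simp add: omega_magma_morphism_def)
  have "\<exists>k. omega_magma_morphism ?Q N k \<and> eq_on_cells M (\<lambda>j x. k j (?q j x)) h \<and>
           (\<forall>k'. omega_magma_morphism ?Q N k' \<and> eq_on_cells M (\<lambda>j x. k' j (?q j x)) h
              \<longrightarrow> eq_on_cells ?Q k' k)"
    if N: "omega_magma N" and h: "omega_magma_morphism M N h"
      and hE: "eq_on_cells (equivalence_magma M E) (\<lambda>j x. h j (fst x)) (\<lambda>j x. h j (snd x))"
    for N :: "'z omega_magma" and h
  proof -
    have hg: "omega_graph_morphism M N h" using h by (simp add: omega_magma_morphism_def)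
    interpret interpretation_of_graph ?G N h
      using N hg underlying_graph_omega_graph[OF M]
      by (simp add: interpretation_of_graph_def interpretation_of_graph_axioms_def)
    have r: "resp_rels ?G ?S N h"
      unfolding resp_rels_def
    proof (intro allI impI, elim conjE)
      fix j t s assume "(t, s) \<in> ?S j"
      then consider x y where "t = Gen x" "s = Gen y" "(x, y) \<in> E j"
        | i x y where "t = Cmp i (Gen x) (Gen y)" "s = Gen (Comp M i j x y)" "composable M i j x y"
        by (auto simp: quotient_rels_def)
      then show "eval N h j t = eval N h j s"
      proof cases
        case 1
        then show ?thesis
          using bspec[OF hE[unfolded eq_on_cells_def, THEN spec, of j], of "(x, y)"]
          by (simp add: equivalence_magma_def)
      next
        case 2
        then show ?thesis using h by (simp add: omega_magma_morphism_def)
      qed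
    qed
    have G_cells: "eq_on_cells ?G a b \<longleftrightarrow> eq_on_cells M a b" for a b :: "nat \<Rightarrow> 'a \<Rightarrow> 'z"
      by (simp add: eq_on_cells_def)
    show ?thesis
      unfolding quotient_magma_def quotient_map_def
    proof (intro exI conjI allI impI)
      show "omega_magma_morphism (presented ?G ?S) N (extend_map N h)"
        by (rule extend_morphism[OF r])
      show "eq_on_cells M (\<lambda>j x. extend_map N h j (gen ?G ?S j x)) h"
        by (rule extend_gen[OF r, unfolded G_cells])
      show "eq_on_cells (presented ?G ?S) k' (extend_map N h)"
        if "omega_magma_morphism (presented ?G ?S) N k' \<and>
            eq_on_cells M (\<lambda>j x. k' j (gen ?G ?S j x)) h" for k'
        using that by (intro extend_unique[OF r, unfolded G_cells]) blast+
    qed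
  qed
  moreover have "eq_on_cells (equivalence_magma M E) (\<lambda>j x. ?q j (fst x)) (\<lambda>j x. ?q j (snd x))"
    using qE by (auto simp: eq_on_cells_def equivalence_magma_def)
  ultimately show ?thesis
    using Q q by (simp add: is_coequalizer_def)
qed

end

theory Submission
  imports Defs
begin

text \<open>
  Three things have to be seen about the quotient map \<open>\<kappa>\<close> from \<open>M\<close> to \<open>M//E\<close>: two cells have the
  same image only if they are \<open>E\<close>-related, every cell of \<open>M//E\<close> is an image, and \<open>M//E\<close> satisfies
  the laws of a strict omega category.  The remaining clauses of a categorical Penon morphism are
  then the two clauses of \<open>R\<close> being a witness to \<open>E\<close>, with the relation \<open>E\<close> read as equality of
  images.

  \<^emph>\<open>Kernel and image.\<close>  Sharpness says exactly that two classes of \<open>E\<close> whose boundaries match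
  contain composable representatives.  Hence the \<open>E\<close>-classes themselves form an omega magma
  (\<open>class_magma\<close>), and the class map coequalizes the projections of \<open>E\<close>.  Comparing this magma with
  \<open>M//E\<close> through the universal property of the latter gives both claims
  (\<open>quotient_map_kernel\<close>, \<open>quotient_map_surj\<close>).

  \<^emph>\<open>Strictness.\<close>  Each law, instantiated at cells of \<open>M\<close> all of whose composites exist in \<open>M\<close>,
  compares two cells of \<open>L(UM)\<close> with the same image in \<open>C(UM)\<close>; as \<open>E\<close> is categorical, the law
  holds in \<open>M\<close> up to \<open>E\<close> (\<open>assoc_up_to\<close> and its companions).  To deduce a law of \<open>M//E\<close> one must
  represent all the cells in it simultaneously by strictly composable cells of \<open>M\<close>.  Sharpness
  treats only one pair at a time and moves both of its members, so it cannot be iterated along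
  \<open>a \<circ> b \<circ> c\<close>.  The witness can: parallel \<open>E\<close>-related cells \<open>p, q\<close> are joined by
  a bridge that is \<open>E\<close>-related to an identity, so composing a cell with (iterated identities on)
  bridges changes its boundary without leaving its \<open>E\<close>-class, by the unit laws up to \<open>E\<close>.  Doing
  this dimension by dimension, from \<open>0\<close>-cells upwards, puts any \<open>E\<close>-related sphere in place of the
  boundary (\<open>replace_boundary\<close>), and therefore any \<open>E\<close>-related cell in place of the source
  (\<open>replace_source\<close>).  Composable strings in \<open>M//E\<close> are then lifted from left to right
  (\<open>strict_quotient\<close>).
\<close>

section \<open>Iterated faces of composites and identities\<close>

context globular_set
begin

lemma dom_to_dom_to: "i \<le> j \<Longrightarrow> j \<le> k \<Longrightarrow> dom_to X i j (dom_to X j k x) = dom_to X i k x"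
  by (induction k arbitrary: x) (auto simp: le_Suc_eq)

lemma cod_to_cod_to: "i \<le> j \<Longrightarrow> j \<le> k \<Longrightarrow> cod_to X i j (cod_to X j k x) = cod_to X i k x"
  by (induction k arbitrary: x) (auto simp: le_Suc_eq)

lemma dom_to_cod_to:
  "i < j \<Longrightarrow> j \<le> k \<Longrightarrow> x \<in> Cell X k \<Longrightarrow> dom_to X i j (cod_to X j k x) = dom_to X i k x"
proof (induction k arbitrary: x)
  case (Suc k)
  show ?case
  proof (cases "j \<le> k")
    case True
    then show ?thesis using Suc by (simp add: Cod_closed dom_to_Cod)
  next
    case False
    then have "j = Suc k" using Suc.prems by simp
    then show ?thesis by simp
  qed
qed auto

lemma cod_to_dom_to:
  "i < j \<Longrightarrow> j \<le> k \<Longrightarrow> x \<in> Cell X k \<Longrightarrow> cod_to X i j (dom_to X j k x) = cod_to X i k x"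
proof (induction k arbitrary: x)
  case (Suc k)
  show ?case
  proof (cases "j \<le> k")
    case True
    then show ?thesis using Suc by (simp add: Dom_closed cod_to_Dom)
  next
    case False
    then have "j = Suc k" using Suc.prems by simp
    then show ?thesis by simp
  qed
qed auto

lemma parallel_Dom_Cod: "x \<in> Cell X (Suc k) \<Longrightarrow> parallel X k (Dom X k x) (Cod X k x)"
  by (auto simp: parallel_def Dom_closed Cod_closed Dom_Dom Cod_Dom)

end

lemma id_to_Idn: "k < j \<Longrightarrow> id_to X (Suc k) j (Idn X k x) = id_to X k j x"
  by (induction j) (auto simp: less_Suc_eq)

lemma morphism_id_to:
  "omega_graph_morphism X Y F \<Longrightarrow> omega_graph X \<Longrightarrow> i \<le> j \<Longrightarrow> x \<in> Cell X i \<Longrightarrow>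
   id_to X i j x \<in> Cell X j \<and> F j (id_to X i j x) = id_to Y i j (F i x)"
  by (induction j) (auto simp: le_Suc_eq omega_graph.Idn_closed omega_graph_morphism_def)

context omega_graph
begin

lemma id_to_closed: "i \<le> j \<Longrightarrow> x \<in> Cell X i \<Longrightarrow> id_to X i j x \<in> Cell X j"
  by (induction j) (auto simp: le_Suc_eq Idn_closed)

lemma dom_to_id_to:
  "i \<le> k \<Longrightarrow> k \<le> j \<Longrightarrow> x \<in> Cell X k \<Longrightarrow> dom_to X i j (id_to X k j x) = dom_to X i k x"
  by (induction j) (auto simp: le_Suc_eq id_to_closed Dom_Idn)

lemma cod_to_id_to:
  "i \<le> k \<Longrightarrow> k \<le> j \<Longrightarrow> x \<in> Cell X k \<Longrightarrow> cod_to X i j (id_to X k j x) = cod_to X i k x"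
  by (induction j) (auto simp: le_Suc_eq id_to_closed Cod_Idn)

lemma composable_id_left:
  "i < j \<Longrightarrow> a \<in> Cell X j \<Longrightarrow> composable X i j (id_to X i j (dom_to X i j a)) a"
  by (simp add: composable_def id_to_closed cod_to_id_to dom_to_closed)

lemma composable_id_right:
  "i < j \<Longrightarrow> a \<in> Cell X j \<Longrightarrow> composable X i j a (id_to X i j (cod_to X i j a))"
  by (simp add: composable_def id_to_closed dom_to_id_to cod_to_closed)

lemma composable_Idn:
  "composable X i j a b \<Longrightarrow> composable X i (Suc j) (Idn X j a) (Idn X j b)"
  by (simp add: composable_def Idn_closed Dom_Idn Cod_Idn)

end

context omega_magma
begin

lemma composable_Dom:
  "i < j \<Longrightarrow> composable X i (Suc j) a b \<Longrightarrow> composable X i j (Dom X j a) (Dom X j b)"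
  by (auto simp: composable_def Dom_closed cod_to_Dom)

lemma composable_Cod:
  "i < j \<Longrightarrow> composable X i (Suc j) a b \<Longrightarrow> composable X i j (Cod X j a) (Cod X j b)"
  by (auto simp: composable_def Cod_closed dom_to_Cod)

lemma dom_to_Comp:
  "composable X i j a b \<Longrightarrow> l \<le> i \<Longrightarrow> dom_to X l j (Comp X i j a b) = dom_to X l j a"
proof (induction j arbitrary: a b)
  case (Suc j)
  show ?case
  proof (cases "i = j")
    case True
    then show ?thesis using Suc.prems by (simp add: Dom_Comp)
  next
    case False
    then have "i < j" using Suc.prems by (simp add: composable_def)
    then show ?thesis using Suc by (simp add: Dom_Comp' composable_Dom)
  qed
qed (simp add: composable_def)

lemma cod_to_Comp:
  "composable X i j a b \<Longrightarrow> l \<le> i \<Longrightarrow> cod_to X l j (Comp X i j a b) = cod_to X l j b"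
proof (induction j arbitrary: a b)
  case (Suc j)
  show ?case
  proof (cases "i = j")
    case True
    then show ?thesis using Suc.prems by (simp add: Cod_Comp)
  next
    case False
    then have "i < j" using Suc.prems by (simp add: composable_def)
    then show ?thesis using Suc by (simp add: Cod_Comp' composable_Cod)
  qed
qed (simp add: composable_def)

lemma dom_to_Comp_above:
  "composable X i j a b \<Longrightarrow> i < l \<Longrightarrow> l \<le> j \<Longrightarrow>
   dom_to X l j (Comp X i j a b) = Comp X i l (dom_to X l j a) (dom_to X l j b)"
proof (induction j arbitrary: a b)
  case (Suc j)
  show ?case
  proof (cases "l = Suc j")
    case False
    then have "i < j" "l \<le> j" using Suc.prems by simp_all
    then show ?thesis using Suc by (simp add: Dom_Comp' composable_Dom)
  qed simp
qed simp

lemma cod_to_Comp_above: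
  "composable X i j a b \<Longrightarrow> i < l \<Longrightarrow> l \<le> j \<Longrightarrow>
   cod_to X l j (Comp X i j a b) = Comp X i l (cod_to X l j a) (cod_to X l j b)"
proof (induction j arbitrary: a b)
  case (Suc j)
  show ?case
  proof (cases "l = Suc j")
    case False
    then have "i < j" "l \<le> j" using Suc.prems by simp_all
    then show ?thesis using Suc by (simp add: Cod_Comp' composable_Cod)
  qed simp
qed simp

lemma composable_assoc:
  assumes "composable X i j a b" "composable X i j b c"
  shows "composable X i j (Comp X i j a b) c" "composable X i j a (Comp X i j b c)"
  using assms Comp_closed[OF assms(1)] Comp_closed[OF assms(2)]
    cod_to_Comp[OF assms(1), of i] dom_to_Comp[OF assms(2), of i]
  by (simp_all add: composable_def)

text \<open>
  Three matching conditions suffice for the interchange law: the two middle cells are held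
  together by the globularity of their common faces.
\<close>

lemma composable_interchange:
  assumes ij: "i < j"
    and ab: "composable X j k a b" and cd: "composable X j k c d" and ac: "composable X i k a c"
  shows "composable X i k b d"
    and "composable X i k (Comp X j k a b) (Comp X j k c d)"
    and "composable X j k (Comp X i k a c) (Comp X i k b d)"
proof -
  have cells: "a \<in> Cell X k" "b \<in> Cell X k" "c \<in> Cell X k" "d \<in> Cell X k" "j < k" "i < k"
    using ab cd ac by (simp_all add: composable_def)
  have "cod_to X i k b = cod_to X i j (dom_to X j k b)"
    using cells ij by (simp add: cod_to_dom_to)
  also have "\<dots> = cod_to X i j (cod_to X j k a)"
    using ab by (simp add: composable_def)
  also have "\<dots> = dom_to X i k c"
    using cells ij ac by (simp add: cod_to_cod_to composable_def)
  finally have bc: "cod_to X i k b = dom_to X i k c" .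
  also have "\<dots> = dom_to X i j (cod_to X j k c)"
    using cells ij by (simp add: dom_to_cod_to)
  also have "\<dots> = dom_to X i k d"
    using cells ij cd by (simp add: dom_to_dom_to composable_def)
  finally show bd: "composable X i k b d"
    using cells by (simp add: composable_def)
  from bc show "composable X i k (Comp X j k a b) (Comp X j k c d)"
    using cells ij ab cd
    by (simp add: composable_def[of X i] Comp_closed cod_to_Comp dom_to_Comp)
  have "cod_to X j k a = dom_to X j k b" "cod_to X j k c = dom_to X j k d"
    using ab cd by (simp_all add: composable_def)
  then show "composable X j k (Comp X i k a c) (Comp X i k b d)"
    using cells ij ac bd
    by (simp add: composable_def[of X j] Comp_closed cod_to_Comp_above dom_to_Comp_above)
qed

lemma bridge_magma_diagonal: "bridge_magma X (diagonal_bridge X)"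
  unfolding bridge_magma_def bridge_relation_def diagonal_bridge_def
  using omega_magma_axioms by (auto simp: Idn_closed Dom_Idn Cod_Idn parallel_def)

end

lemma omega_magma_morphismD:
  assumes "omega_magma_morphism X Y F"
  shows "x \<in> Cell X i \<Longrightarrow> F i x \<in> Cell Y i"
    and "x \<in> Cell X (Suc i) \<Longrightarrow> F i (Dom X i x) = Dom Y i (F (Suc i) x)"
    and "x \<in> Cell X (Suc i) \<Longrightarrow> F i (Cod X i x) = Cod Y i (F (Suc i) x)"
    and "x \<in> Cell X i \<Longrightarrow> F (Suc i) (Idn X i x) = Idn Y i (F i x)"
    and "composable X i j a b \<Longrightarrow> F j (Comp X i j a b) = Comp Y i j (F j a) (F j b)"
    and "globular_set_morphism X Y F"
    and "omega_graph_morphism X Y F"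
  using assms
  by (simp_all add: omega_magma_morphism_def omega_graph_morphism_def globular_set_morphism_def)

section \<open>Omega magma equivalence relations\<close>

lemma dom_to_prod_magma: "dom_to (prod_magma X Y) i j (x, y) = (dom_to X i j x, dom_to Y i j y)"
  by (induction j arbitrary: x y) (auto simp: prod_magma_def)

lemma cod_to_prod_magma: "cod_to (prod_magma X Y) i j (x, y) = (cod_to X i j x, cod_to Y i j y)"
  by (induction j arbitrary: x y) (auto simp: prod_magma_def)

lemma composable_prod_magma:
  "composable (prod_magma X Y) i j (a, a') (b, b') \<longleftrightarrow> composable X i j a b \<and> composable Y i j a' b'"
  by (auto simp: composable_def dom_to_prod_magma cod_to_prod_magma) (auto simp: prod_magma_def)

locale magma_equivalence = omega_magma M for M :: "'a omega_magma" +
  fixes E :: "nat \<Rightarrow> ('a \<times> 'a) set"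
  assumes equivalence: "omega_magma_equivalence M E"
begin

lemma equiv: "equiv (Cell M j) (E j)"
  using equivalence by (simp add: omega_magma_equivalence_def)

lemma E_refl: "x \<in> Cell M j \<Longrightarrow> (x, x) \<in> E j"
  using equiv by (rule equiv_class_self[THEN ImageE]) auto

lemma E_sym: "(x, y) \<in> E j \<Longrightarrow> (y, x) \<in> E j"
  using equiv[of j] by (auto simp: equiv_def dest: symD)

lemma E_trans [trans]: "(x, y) \<in> E j \<Longrightarrow> (y, z) \<in> E j \<Longrightarrow> (x, z) \<in> E j"
  using equiv[of j] by (auto simp: equiv_def dest: transD)

lemma E_closed: "(x, y) \<in> E j \<Longrightarrow> x \<in> Cell M j" "(x, y) \<in> E j \<Longrightarrow> y \<in> Cell M j"
  using equivalence
  by (auto simp: omega_magma_equivalence_def omega_submagma_def prod_magma_def)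

lemma E_Dom: "(x, y) \<in> E (Suc j) \<Longrightarrow> (Dom M j x, Dom M j y) \<in> E j"
  and E_Cod: "(x, y) \<in> E (Suc j) \<Longrightarrow> (Cod M j x, Cod M j y) \<in> E j"
  and E_Idn: "(x, y) \<in> E j \<Longrightarrow> (Idn M j x, Idn M j y) \<in> E (Suc j)"
  using equivalence
  by (force simp: omega_magma_equivalence_def omega_submagma_def prod_magma_def)+

lemma E_Comp:
  assumes "(a, a') \<in> E j" "(b, b') \<in> E j" "composable M i j a b" "composable M i j a' b'"
  shows "(Comp M i j a b, Comp M i j a' b') \<in> E j"
proof -
  have "Comp (prod_magma M M) i j (a, a') (b, b') \<in> E j"
    using assms equivalence composable_prod_magma[of M M i j a a' b b']
    unfolding omega_magma_equivalence_def omega_submagma_def by blast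
  then show ?thesis by (simp add: prod_magma_def)
qed

lemma E_dom_to: "i \<le> j \<Longrightarrow> (x, y) \<in> E j \<Longrightarrow> (dom_to M i j x, dom_to M i j y) \<in> E i"
  by (induction j arbitrary: x y) (auto simp: le_Suc_eq E_Dom)

lemma E_cod_to: "i \<le> j \<Longrightarrow> (x, y) \<in> E j \<Longrightarrow> (cod_to M i j x, cod_to M i j y) \<in> E i"
  by (induction j arbitrary: x y) (auto simp: le_Suc_eq E_Cod)

lemma E_id_to: "i \<le> j \<Longrightarrow> (x, y) \<in> E i \<Longrightarrow> (id_to M i j x, id_to M i j y) \<in> E j"
  by (induction j) (auto simp: le_Suc_eq E_Idn)

lemma class_eq_iff:
  "x \<in> Cell M j \<Longrightarrow> y \<in> Cell M j \<Longrightarrow> E j `` {x} = E j `` {y} \<longleftrightarrow> (x, y) \<in> E j"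
  by (rule eq_equiv_class_iff[OF equiv])

end

section \<open>The quotient by a sharp equivalence relation\<close>

text \<open>
  A composite of classes is formed from representatives that compose in \<open>M\<close>; for matching classes
  of a sharp relation such representatives exist, and by the submagma property the union below
  is then a single class.
\<close>

definition class_magma :: "'a omega_magma \<Rightarrow> (nat \<Rightarrow> ('a \<times> 'a) set) \<Rightarrow> 'a set omega_magma" where
  "class_magma M E =
    \<lparr>Cell = (\<lambda>j. Cell M j // E j),
     Dom = (\<lambda>j A. \<Union>x\<in>A. E j `` {Dom M j x}),
     Cod = (\<lambda>j A. \<Union>x\<in>A. E j `` {Cod M j x}),
     Idn = (\<lambda>j A. \<Union>x\<in>A. E (Suc j) `` {Idn M j x}),
     Comp = (\<lambda>i j A B. \<Union>{E j `` {Comp M i j a b} | a b. a \<in> A \<and> b \<in> B \<and> composable M i j a b})\<rparr>"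

locale sharp_equivalence = magma_equivalence +
  assumes sharp: "sharp M E"
begin

abbreviation "Q \<equiv> class_magma M E"
abbreviation "class_of \<equiv> \<lambda>j x. E j `` {x}"

lemma Cell_class_magma: "A \<in> Cell Q j \<longleftrightarrow> (\<exists>x \<in> Cell M j. A = class_of j x)"
  by (auto simp: class_magma_def quotient_def)

lemma union_classes:
  assumes "x \<in> Cell M j" "\<And>y. (x, y) \<in> E j \<Longrightarrow> (f x, f y) \<in> E k"
  shows "(\<Union>y\<in>class_of j x. class_of k (f y)) = class_of k (f x)"
proof -
  have "class_of k (f y) = class_of k (f x)" if "(x, y) \<in> E j" for y
    using equiv_class_eq[OF equiv assms(2)[OF that]] by simp
  moreover have "x \<in> class_of j x" using E_refl[OF assms(1)] by simp
  ultimately show ?thesis by blast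
qed

lemma Dom_class: "x \<in> Cell M (Suc j) \<Longrightarrow> Dom Q j (class_of (Suc j) x) = class_of j (Dom M j x)"
  using union_classes[of x "Suc j" "Dom M j" j] by (simp add: class_magma_def E_Dom)

lemma Cod_class: "x \<in> Cell M (Suc j) \<Longrightarrow> Cod Q j (class_of (Suc j) x) = class_of j (Cod M j x)"
  using union_classes[of x "Suc j" "Cod M j" j] by (simp add: class_magma_def E_Cod)

lemma Idn_class: "x \<in> Cell M j \<Longrightarrow> Idn Q j (class_of j x) = class_of (Suc j) (Idn M j x)"
  using union_classes[of x j "Idn M j" "Suc j"] by (simp add: class_magma_def E_Idn)

lemma Comp_class:
  assumes "composable M i j a b"
  shows "Comp Q i j (class_of j a) (class_of j b) = class_of j (Comp M i j a b)"
proof -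
  have "class_of j (Comp M i j x y) = class_of j (Comp M i j a b)"
    if "(a, x) \<in> E j" "(b, y) \<in> E j" "composable M i j x y" for x y
    using equiv_class_eq[OF equiv E_Comp[OF that(1,2) assms that(3)]] by simp
  moreover have "a \<in> class_of j a" "b \<in> class_of j b"
    using assms by (simp_all add: composable_def E_refl)
  ultimately have "{class_of j (Comp M i j x y) | x y. x \<in> class_of j a \<and> y \<in> class_of j b \<and>
      composable M i j x y} = {class_of j (Comp M i j a b)}"
    using assms by blast
  then show ?thesis by (simp add: class_magma_def)
qed

lemma class_morphism_graph: "omega_graph_morphism M Q class_of"
  unfolding omega_graph_morphism_def globular_set_morphism_def
  by (auto simp: Cell_class_magma Dom_class Cod_class Idn_class)

lemma composable_classes:
  assumes "composable Q i j A B"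
  obtains a b where "A = class_of j a" "B = class_of j b" "composable M i j a b"
proof -
  obtain x y where x: "x \<in> Cell M j" "A = class_of j x" and y: "y \<in> Cell M j" "B = class_of j y"
    using assms by (auto simp: composable_def Cell_class_magma)
  have ij: "i < j" using assms by (simp add: composable_def)
  have g: "globular_set_morphism M Q class_of"
    using class_morphism_graph by (simp add: omega_graph_morphism_def)
  have "class_of i (cod_to M i j x) = class_of i (dom_to M i j y)"
    using assms x y ij morphism_cod_to[OF g globular_set_axioms, of i j x]
      morphism_dom_to[OF g globular_set_axioms, of i j y]
    by (simp add: composable_def)
  then have "(cod_to M i j x, dom_to M i j y) \<in> E i"
    using x y ij class_eq_iff[of "cod_to M i j x" i "dom_to M i j y"]
    by (simp add: cod_to_closed dom_to_closed)
  then obtain a b where ab: "(x, a) \<in> E j" "(y, b) \<in> E j" "cod_to M i j a = dom_to M i j b"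
    using sharp x(1) y(1) ij unfolding sharp_def by meson
  have "composable M i j a b"
    using ab ij E_closed by (auto simp: composable_def)
  moreover have "A = class_of j a" "B = class_of j b"
    using x y ab equiv_class_eq[OF equiv] by simp_all
  ultimately show thesis by (rule that[rotated 2])
qed

lemma omega_magma_class_magma: "omega_magma Q"
proof -
  have faces: "Dom Q i A \<in> Cell Q i" "Cod Q i A \<in> Cell Q i" if "A \<in> Cell Q (Suc i)" for A i
    using that by (auto simp: Cell_class_magma Dom_class Cod_class intro: Dom_closed Cod_closed)
  show ?thesis
  proof
    fix A i assume "A \<in> Cell Q (Suc (Suc i))"
    then show "Dom Q i (Dom Q (Suc i) A) = Dom Q i (Cod Q (Suc i) A)"
      "Cod Q i (Dom Q (Suc i) A) = Cod Q i (Cod Q (Suc i) A)"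
      by (auto simp: Cell_class_magma Dom_class Cod_class Dom_closed Cod_closed Dom_Dom Cod_Dom)
  next
    fix A i assume "A \<in> Cell Q i"
    then show "Idn Q i A \<in> Cell Q (Suc i)" "Dom Q i (Idn Q i A) = A" "Cod Q i (Idn Q i A) = A"
      by (auto simp: Cell_class_magma Idn_class Dom_class Cod_class Idn_closed Dom_Idn Cod_Idn)
  next
    fix i j A B assume "composable Q i j A B"
    then show "Comp Q i j A B \<in> Cell Q j"
      by (rule composable_classes) (auto simp: Comp_class Cell_class_magma intro: Comp_closed)
  next
    fix i A B assume "composable Q i (Suc i) A B"
    then obtain a b where "A = class_of (Suc i) a" "B = class_of (Suc i) b" "composable M i (Suc i) a b"
      by (rule composable_classes)
    moreover from this have "a \<in> Cell M (Suc i)" "b \<in> Cell M (Suc i)"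
      by (simp_all add: composable_def)
    ultimately show "Dom Q i (Comp Q i (Suc i) A B) = Dom Q i A"
      "Cod Q i (Comp Q i (Suc i) A B) = Cod Q i B"
      by (simp_all add: Comp_class Dom_class Cod_class Comp_closed Dom_Comp Cod_Comp)
  next
    fix i j :: nat and A B assume ij: "i < j" and "composable Q i (Suc j) A B"
    from this(2) obtain a b
      where "A = class_of (Suc j) a" "B = class_of (Suc j) b" "composable M i (Suc j) a b"
      by (rule composable_classes)
    moreover from this have "a \<in> Cell M (Suc j)" "b \<in> Cell M (Suc j)"
      by (simp_all add: composable_def)
    ultimately show "Dom Q j (Comp Q i (Suc j) A B) = Comp Q i j (Dom Q j A) (Dom Q j B)"
      "Cod Q j (Comp Q i (Suc j) A B) = Comp Q i j (Cod Q j A) (Cod Q j B)"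
      using ij
      by (simp_all add: Comp_class Dom_class Cod_class Comp_closed Dom_Comp' Cod_Comp'
          composable_Dom composable_Cod)
  qed (use faces in auto)
qed

lemma class_morphism: "omega_magma_morphism M Q class_of"
  using class_morphism_graph by (simp add: omega_magma_morphism_def Comp_class)

lemma class_coequalizes:
  "eq_on_cells (equivalence_magma M E) (\<lambda>j x. class_of j (fst x)) (\<lambda>j x. class_of j (snd x))"
  using equiv_class_eq[OF equiv] by (auto simp: eq_on_cells_def equivalence_magma_def)

end

context magma_equivalence
begin

abbreviation "\<kappa> \<equiv> quotient_map M E"

lemma quotient_magma: "omega_magma (M //\<^sub>\<omega> E)"
  by (simp add: quotient_magma_def presented_omega_magma)

lemma quotient_map_morphism: "omega_magma_morphism M (M //\<^sub>\<omega> E) \<kappa>"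
  using quotient_magma_is_coequalizer[OF omega_magma_axioms equivalence, where 'z=unit]
  by (simp add: is_coequalizer_def)

lemma quotient_map_coequalizes:
  "eq_on_cells (equivalence_magma M E) (\<lambda>j x. \<kappa> j (fst x)) (\<lambda>j x. \<kappa> j (snd x))"
  using quotient_magma_is_coequalizer[OF omega_magma_axioms equivalence, where 'z=unit]
  by (simp add: is_coequalizer_def)

lemma quotient_map_eqI: "(x, y) \<in> E j \<Longrightarrow> \<kappa> j x = \<kappa> j y"
  using quotient_map_coequalizes unfolding eq_on_cells_def equivalence_magma_def by force

lemma quotient_map_factor:
  fixes N :: "'z omega_magma"
  assumes "omega_magma N" "omega_magma_morphism M N h"
    and "eq_on_cells (equivalence_magma M E) (\<lambda>j x. h j (fst x)) (\<lambda>j x. h j (snd x))"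
  obtains k where "omega_magma_morphism (M //\<^sub>\<omega> E) N k" "eq_on_cells M (\<lambda>j x. k j (\<kappa> j x)) h"
    "\<And>k'. omega_magma_morphism (M //\<^sub>\<omega> E) N k' \<Longrightarrow> eq_on_cells M (\<lambda>j x. k' j (\<kappa> j x)) h \<Longrightarrow>
      eq_on_cells (M //\<^sub>\<omega> E) k' k"
  using quotient_magma_is_coequalizer[OF omega_magma_axioms equivalence, where 'z='z] assms
  unfolding is_coequalizer_def by blast

end

context sharp_equivalence
begin

text \<open>The class map factors through \<open>\<kappa>\<close>, so \<open>\<kappa>\<close> cannot identify more than it does.\<close>

lemma quotient_map_kernel:
  assumes "x \<in> Cell M j" "y \<in> Cell M j"
  shows "\<kappa> j x = \<kappa> j y \<longleftrightarrow> (x, y) \<in> E j"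
proof
  assume eq: "\<kappa> j x = \<kappa> j y"
  obtain k where "eq_on_cells M (\<lambda>j x. k j (\<kappa> j x)) class_of"
    using quotient_map_factor[OF omega_magma_class_magma class_morphism class_coequalizes] by blast
  then have "class_of j x = k j (\<kappa> j x)" "class_of j y = k j (\<kappa> j y)"
    using assms by (simp_all add: eq_on_cells_def)
  then show "(x, y) \<in> E j" using eq class_eq_iff[OF assms] by simp
qed (rule quotient_map_eqI)

text \<open>
  Conversely \<open>\<kappa>\<close> factors through the class map, by \<open>r\<close>.  The composite of the two comparison maps is
  an endomorphism of \<open>M//E\<close> fixing the image of \<open>\<kappa>\<close>, hence it is the identity; but its values
  are visibly in the image of \<open>\<kappa>\<close>.
\<close>

lemma quotient_map_surj:
  assumes "A \<in> Cell (M //\<^sub>\<omega> E) j"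
  shows "\<exists>x \<in> Cell M j. \<kappa> j x = A"
proof -
  let ?P = "M //\<^sub>\<omega> E"
  obtain k where k: "omega_magma_morphism ?P Q k" "eq_on_cells M (\<lambda>j x. k j (\<kappa> j x)) class_of"
    using quotient_map_factor[OF omega_magma_class_magma class_morphism class_coequalizes] by blast
  define r where "r j A = \<kappa> j (SOME x. x \<in> A)" for j and A :: "'a set"
  have r: "r j (class_of j x) = \<kappa> j x" if "x \<in> Cell M j" for j x
  proof -
    have "(x, SOME y. y \<in> class_of j x) \<in> E j"
      using someI[of "\<lambda>y. y \<in> class_of j x" x] E_refl[OF that] by simp
    then show ?thesis by (simp add: r_def quotient_map_eqI)
  qed
  note \<kappa> = omega_magma_morphismD[OF quotient_map_morphism]
  have rm: "omega_magma_morphism Q ?P r"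
    unfolding omega_magma_morphism_def omega_graph_morphism_def globular_set_morphism_def
  proof (intro conjI allI ballI impI)
    fix i j A B assume "composable Q i j A B"
    then obtain a b where ab: "A = class_of j a" "B = class_of j b" "composable M i j a b"
      by (rule composable_classes)
    then have "a \<in> Cell M j" "b \<in> Cell M j" by (simp_all add: composable_def)
    then show "r j (Comp Q i j A B) = Comp ?P i j (r j A) (r j B)"
      using ab by (simp add: Comp_class r \<kappa>(5) Comp_closed)
  qed (auto simp: Cell_class_magma Dom_class Cod_class Idn_class r
      Dom_closed Cod_closed Idn_closed \<kappa>(1-4))
  have endo: "omega_magma_morphism ?P ?P (\<lambda>j x. r j (k j x))"
    by (rule omega_magma_morphism_comp[OF quotient_magma k(1) rm])
  have fixes_image: "eq_on_cells M (\<lambda>j x. r j (k j (\<kappa> j x))) \<kappa>"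
    using k(2) by (simp add: eq_on_cells_def r)
  have ident: "omega_magma_morphism ?P ?P (\<lambda>j x. x)"
    by (simp add: omega_magma_morphism_def omega_graph_morphism_def globular_set_morphism_def)
  obtain l where l: "\<And>k'. omega_magma_morphism ?P ?P k' \<Longrightarrow>
      eq_on_cells M (\<lambda>j x. k' j (\<kappa> j x)) \<kappa> \<Longrightarrow> eq_on_cells ?P k' l"
    using quotient_map_factor[OF quotient_magma quotient_map_morphism quotient_map_coequalizes]
    by blast
  have "r j (k j A) = A"
    using l[OF endo fixes_image] l[OF ident] assms by (simp add: eq_on_cells_def)
  moreover obtain x where "x \<in> Cell M j" "k j A = class_of j x"
    using omega_magma_morphismD(1)[OF k(1) assms] by (auto simp: Cell_class_magma)
  ultimately show ?thesis using r by auto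
qed

end

section \<open>Strict laws up to a categorical equivalence relation\<close>

locale categorical_equivalence = magma_equivalence +
  assumes categorical: "categorical M E"
begin

abbreviation "L \<equiv> free_omega_magma (underlying_graph M)"
abbreviation "C \<equiv> free_strict_category (underlying_graph M)"
abbreviation "g \<equiv> gen (underlying_graph M) (\<lambda>_. {})"

lemma L: "omega_magma L"
  by (simp add: free_omega_magma_def presented_omega_magma)

lemma C: "strict_omega_category C"
  by (simp add: free_strict_category_def strict_presented)

lemma g: "omega_graph_morphism M L g"
  using gen_morphism[of "underlying_graph M" "\<lambda>_. {}"] by (simp add: free_omega_magma_def)

lemma g_globular: "globular_set_morphism M L g"
  using g by (simp add: omega_graph_morphism_def)

lemma g_closed: "x \<in> Cell M j \<Longrightarrow> g j x \<in> Cell L j"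
  using g_globular by (simp add: globular_set_morphism_def)

lemmas composable_g = morphism_composable[OF g_globular globular_set_axioms]
lemmas counit = omega_magma_morphismD[OF counit_morphism(1)[OF omega_magma_axioms]]
lemmas counit_g = counit_morphism(2)[OF omega_magma_axioms]
lemmas canonical = omega_magma_morphismD[OF canonical_map_morphism(1)[OF omega_magma_axioms]]
lemmas composable_canonical =
  morphism_composable[OF canonical(6) omega_magma_globular[OF L]]

lemma E_counitI:
  "u \<in> Cell L j \<Longrightarrow> v \<in> Cell L j \<Longrightarrow> canonical_map M j u = canonical_map M j v \<Longrightarrow>
   (counit M j u, counit M j v) \<in> E j"
  using categorical by (simp add: categorical_def)

text \<open>
  In each of the following laws the two sides are first formed from generators in \<open>L(UM)\<close>.  The
  counit evaluates them to the cells in the statement, and the canonical map sends them to the two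
  sides of the same law in \<open>C(UM)\<close>, where it holds.
\<close>

lemma assoc_up_to:
  assumes "composable M i j a b" "composable M i j b c"
  shows "(Comp M i j (Comp M i j a b) c, Comp M i j a (Comp M i j b c)) \<in> E j"
proof -
  interpret L: omega_magma L by (rule L)
  interpret C: strict_omega_category C by (rule C)
  note ab = composable_g[OF assms(1)] and bc = composable_g[OF assms(2)]
  note ab_c = L.composable_assoc(1)[OF ab bc] and a_bc = L.composable_assoc(2)[OF ab bc]
  let ?u = "Comp L i j (Comp L i j (g j a) (g j b)) (g j c)"
  let ?v = "Comp L i j (g j a) (Comp L i j (g j b) (g j c))"
  have "canonical_map M j ?u = canonical_map M j ?v"
    using C.assoc[OF composable_canonical[OF ab] _ composable_canonical[OF bc]]
      composable_canonical[OF ab_c] composable_canonical[OF a_bc]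
    by (simp add: canonical(5) ab bc ab_c a_bc)
  then have "(counit M j ?u, counit M j ?v) \<in> E j"
    by (rule E_counitI[OF L.Comp_closed[OF ab_c] L.Comp_closed[OF a_bc]])
  moreover have "a \<in> Cell M j" "b \<in> Cell M j" "c \<in> Cell M j"
    using assms by (simp_all add: composable_def)
  ultimately show ?thesis
    by (simp add: counit(5) ab bc ab_c a_bc counit_g)
qed

lemma interchange_up_to:
  assumes ij: "i < j"
    and "composable M j k a b" "composable M j k c d" "composable M i k a c"
  shows "(Comp M i k (Comp M j k a b) (Comp M j k c d),
          Comp M j k (Comp M i k a c) (Comp M i k b d)) \<in> E k"
proof -
  interpret L: omega_magma L by (rule L)
  interpret C: strict_omega_category C by (rule C)
  have jk: "j < k" using assms(2) by (simp add: composable_def)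
  note h = assms(2-4)[THEN composable_g]
  note h' = L.composable_interchange[OF ij h]
  let ?u = "Comp L i k (Comp L j k (g k a) (g k b)) (Comp L j k (g k c) (g k d))"
  let ?v = "Comp L j k (Comp L i k (g k a) (g k c)) (Comp L i k (g k b) (g k d))"
  have "canonical_map M k ?u = canonical_map M k ?v"
    using C.interchange[OF ij jk h(1,2)[THEN composable_canonical] _
        h(3)[THEN composable_canonical] h'(1)[THEN composable_canonical]]
      h'(2,3)[THEN composable_canonical]
    by (simp add: canonical(5) h h')
  then have "(counit M k ?u, counit M k ?v) \<in> E k"
    by (rule E_counitI[OF L.Comp_closed[OF h'(2)] L.Comp_closed[OF h'(3)]])
  moreover have "a \<in> Cell M k" "b \<in> Cell M k" "c \<in> Cell M k" "d \<in> Cell M k"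
    using assms by (simp_all add: composable_def)
  ultimately show ?thesis
    by (simp add: counit(5) h h' counit_g)
qed

lemma id_left_up_to:
  assumes ij: "i < j" and a: "a \<in> Cell M j"
  shows "(Comp M i j (id_to M i j (dom_to M i j a)) a, a) \<in> E j"
proof -
  interpret L: omega_magma L by (rule L)
  interpret C: strict_omega_category C by (rule C)
  note ga = g_closed[OF a]
  have d: "dom_to L i j (g j a) \<in> Cell L i" using ij ga by (simp add: L.dom_to_closed)
  note c = L.composable_id_left[OF ij ga]
  let ?u = "Comp L i j (id_to L i j (dom_to L i j (g j a))) (g j a)"
  have "canonical_map M j ?u = canonical_map M j (g j a)"
    using C.id_left[OF ij canonical(1)[OF ga]] ij ga
    by (simp add: canonical(5) c d morphism_id_to[OF canonical(7) L.omega_graph_axioms]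
        morphism_dom_to[OF canonical(6) L.globular_set_axioms])
  then have "(counit M j ?u, counit M j (g j a)) \<in> E j"
    by (rule E_counitI[OF L.Comp_closed[OF c] ga])
  then show ?thesis
    using ij a ga
    by (simp add: counit(5) c d counit_g morphism_id_to[OF counit(7) L.omega_graph_axioms]
        morphism_dom_to[OF counit(6) L.globular_set_axioms])
qed

lemma id_right_up_to:
  assumes ij: "i < j" and a: "a \<in> Cell M j"
  shows "(Comp M i j a (id_to M i j (cod_to M i j a)), a) \<in> E j"
proof -
  interpret L: omega_magma L by (rule L)
  interpret C: strict_omega_category C by (rule C)
  note ga = g_closed[OF a]
  have d: "cod_to L i j (g j a) \<in> Cell L i" using ij ga by (simp add: L.cod_to_closed)
  note c = L.composable_id_right[OF ij ga]
  let ?u = "Comp L i j (g j a) (id_to L i j (cod_to L i j (g j a)))"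
  have "canonical_map M j ?u = canonical_map M j (g j a)"
    using C.id_right[OF ij canonical(1)[OF ga]] ij ga
    by (simp add: canonical(5) c d morphism_id_to[OF canonical(7) L.omega_graph_axioms]
        morphism_cod_to[OF canonical(6) L.globular_set_axioms])
  then have "(counit M j ?u, counit M j (g j a)) \<in> E j"
    by (rule E_counitI[OF L.Comp_closed[OF c] ga])
  then show ?thesis
    using ij a ga
    by (simp add: counit(5) c d counit_g morphism_id_to[OF counit(7) L.omega_graph_axioms]
        morphism_cod_to[OF counit(6) L.globular_set_axioms])
qed

lemma Idn_Comp_up_to:
  assumes "composable M i j a b"
  shows "(Comp M i (Suc j) (Idn M j a) (Idn M j b), Idn M j (Comp M i j a b)) \<in> E (Suc j)"
proof -
  interpret L: omega_magma L by (rule L)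
  interpret C: strict_omega_category C by (rule C)
  note ab = composable_g[OF assms]
  note Iab = L.composable_Idn[OF ab]
  have cells: "a \<in> Cell M j" "b \<in> Cell M j" "g j a \<in> Cell L j" "g j b \<in> Cell L j"
    using assms ab by (simp_all add: composable_def)
  let ?u = "Comp L i (Suc j) (Idn L j (g j a)) (Idn L j (g j b))"
  let ?v = "Idn L j (Comp L i j (g j a) (g j b))"
  have "canonical_map M (Suc j) ?u = canonical_map M (Suc j) ?v"
    using C.Idn_Comp[OF composable_canonical[OF ab]] cells
    by (simp add: canonical(4,5) ab Iab L.Comp_closed)
  then have "(counit M (Suc j) ?u, counit M (Suc j) ?v) \<in> E (Suc j)"
    by (rule E_counitI[OF L.Comp_closed[OF Iab] L.Idn_closed[OF L.Comp_closed[OF ab]]])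
  then show ?thesis
    using cells by (simp add: counit(4,5) ab Iab L.Comp_closed counit_g)
qed

end

section \<open>Moving the boundary of a cell along bridges\<close>

locale witnessed_equivalence = categorical_equivalence +
  fixes R
  assumes bridge: "bridge_relation M R"
    and witness: "witness M E R"
begin

lemma obtain_bridge:
  assumes "parallel M k p q" "(p, q) \<in> E k"
  obtains s where "s \<in> Cell M (Suc k)" "Dom M k s = p" "Cod M k s = q"
    "(s, Idn M k p) \<in> E (Suc k)" "(s, Idn M k q) \<in> E (Suc k)"
proof -
  obtain s where s: "(p, q, s) \<in> R k"
    using assms witness unfolding witness_def by blast
  moreover have "s \<in> Cell M (Suc k)" "Dom M k s = p" "Cod M k s = q"
    using s bridge unfolding bridge_relation_def by blast+
  ultimately show thesis
    using witness that unfolding witness_def by blast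
qed

text \<open>
  The new cell is \<open>s \<circ> y\<close> for a bridge \<open>s\<close> from \<open>p\<close> to the source of \<open>y\<close>, raised to the dimension
  of \<open>y\<close>.  As \<open>s\<close> is \<open>E\<close>-related to an identity, \<open>s \<circ> y\<close> is \<open>E\<close>-related to \<open>y\<close>.
\<close>

lemma attach_bridge_left:
  assumes y: "y \<in> Cell M j" and kj: "k < j"
    and p: "parallel M k p (dom_to M k j y)" "(p, dom_to M k j y) \<in> E k"
  obtains y' where "(y, y') \<in> E j" "dom_to M k j y' = p" "cod_to M k j y' = cod_to M k j y"
proof -
  let ?d = "dom_to M k j y"
  obtain s where s: "s \<in> Cell M (Suc k)" "Dom M k s = p" "Cod M k s = ?d"
    "(s, Idn M k ?d) \<in> E (Suc k)"
    using obtain_bridge[OF p] by blast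
  let ?t = "id_to M (Suc k) j s"
  have t: "?t \<in> Cell M j" "dom_to M k j ?t = p" "cod_to M k j ?t = ?d"
    using s kj by (simp_all add: id_to_closed dom_to_id_to cod_to_id_to)
  have c: "composable M k j ?t y"
    using t y kj by (simp add: composable_def)
  have "(?t, id_to M k j ?d) \<in> E j"
    using E_id_to[OF _ s(4), of j] kj by (simp add: id_to_Idn)
  then have "(Comp M k j ?t y, Comp M k j (id_to M k j ?d) y) \<in> E j"
    by (rule E_Comp[OF _ E_refl[OF y] c composable_id_left[OF kj y]])
  also have "(Comp M k j (id_to M k j ?d) y, y) \<in> E j"
    by (rule id_left_up_to[OF kj y])
  finally have "(y, Comp M k j ?t y) \<in> E j" by (rule E_sym)
  then show thesis
    by (rule that) (simp_all add: dom_to_Comp[OF c] cod_to_Comp[OF c] t)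
qed

lemma attach_bridge_right:
  assumes y: "y \<in> Cell M j" and kj: "k < j"
    and q: "parallel M k (cod_to M k j y) q" "(cod_to M k j y, q) \<in> E k"
  obtains y' where "(y, y') \<in> E j" "dom_to M k j y' = dom_to M k j y" "cod_to M k j y' = q"
proof -
  let ?c = "cod_to M k j y"
  obtain s where s: "s \<in> Cell M (Suc k)" "Dom M k s = ?c" "Cod M k s = q"
    "(s, Idn M k ?c) \<in> E (Suc k)"
    using obtain_bridge[OF q] by blast
  let ?t = "id_to M (Suc k) j s"
  have t: "?t \<in> Cell M j" "dom_to M k j ?t = ?c" "cod_to M k j ?t = q"
    using s kj by (simp_all add: id_to_closed dom_to_id_to cod_to_id_to)
  have c: "composable M k j y ?t"
    using t y kj by (simp add: composable_def)
  have "(?t, id_to M k j ?c) \<in> E j"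
    using E_id_to[OF _ s(4), of j] kj by (simp add: id_to_Idn)
  then have "(Comp M k j y ?t, Comp M k j y (id_to M k j ?c)) \<in> E j"
    by (rule E_Comp[OF E_refl[OF y] _ c composable_id_right[OF kj y]])
  also have "(Comp M k j y (id_to M k j ?c), y) \<in> E j"
    by (rule id_right_up_to[OF kj y])
  finally have "(y, Comp M k j y ?t) \<in> E j" by (rule E_sym)
  then show thesis
    by (rule that) (simp_all add: dom_to_Comp[OF c] cod_to_Comp[OF c] t)
qed

text \<open>
  Bridges join parallel cells only, while \<open>p\<close> and the \<open>k\<close>-source of \<open>y\<close> need not be parallel.  So
  the boundary is first corrected one dimension lower, to the common boundary of \<open>p\<close> and \<open>q\<close>.
\<close>

lemma replace_boundary:
  assumes y: "y \<in> Cell M j"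
  shows "k < j \<Longrightarrow> parallel M k p q \<Longrightarrow>
    (p, dom_to M k j y) \<in> E k \<Longrightarrow> (q, cod_to M k j y) \<in> E k \<Longrightarrow>
    \<exists>y'. (y, y') \<in> E j \<and> dom_to M k j y' = p \<and> cod_to M k j y' = q"
proof (induction k arbitrary: p q)
  \<comment> \<open>the correction in one dimension, of a cell \<open>y1\<close> whose lower boundary is already right\<close>
  have attach: "\<exists>y'. (y, y') \<in> E j \<and> dom_to M k j y' = p \<and> cod_to M k j y' = q"
    if kj: "k < j" and y1: "(y, y1) \<in> E j"
      and p: "parallel M k p (dom_to M k j y1)" "(p, dom_to M k j y) \<in> E k"
      and q: "parallel M k (cod_to M k j y1) q" "(q, cod_to M k j y) \<in> E k" for k p q y1
  proof -
    have "(p, dom_to M k j y1) \<in> E k"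
      using E_trans[OF p(2) E_dom_to[OF _ y1]] kj by simp
    then obtain y2 where y2: "(y1, y2) \<in> E j" "dom_to M k j y2 = p"
        "cod_to M k j y2 = cod_to M k j y1"
      using attach_bridge_left[OF E_closed(2)[OF y1] kj p(1)] by blast
    have "(cod_to M k j y2, q) \<in> E k"
      using E_sym[OF E_trans[OF q(2) E_cod_to[OF _ y1]]] kj y2(3) by simp
    then obtain y3 where "(y2, y3) \<in> E j" "dom_to M k j y3 = p" "cod_to M k j y3 = q"
      using attach_bridge_right[OF E_closed(2)[OF y2(1)] kj, of q] q(1) y2(2,3) by auto
    then show ?thesis using E_trans[OF E_trans[OF y1 y2(1)]] by blast
  qed
  {
    case 0
    then show ?case
      using E_closed by (intro attach[OF _ E_refl[OF y]]) (auto simp: parallel_def)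
  next
    case (Suc k)
    have cells: "p \<in> Cell M (Suc k)" "q \<in> Cell M (Suc k)"
      and pq: "Dom M k p = Dom M k q" "Cod M k p = Cod M k q"
      using Suc.prems(2) by (simp_all add: parallel_def)
    have d: "Dom M k (dom_to M (Suc k) j z) = dom_to M k j z"
      "Cod M k (dom_to M (Suc k) j z) = cod_to M k j z"
      "Dom M k (cod_to M (Suc k) j z) = dom_to M k j z"
      "Cod M k (cod_to M (Suc k) j z) = cod_to M k j z"
      if "z \<in> Cell M j" for z
      using Suc.prems(1) that dom_to_dom_to[of k "Suc k" j z] cod_to_dom_to[of k "Suc k" j z]
        dom_to_cod_to[of k "Suc k" j z] cod_to_cod_to[of k "Suc k" j z] by simp_all
    have "\<exists>y1. (y, y1) \<in> E j \<and> dom_to M k j y1 = Dom M k p \<and> cod_to M k j y1 = Cod M k p"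
      using Suc.prems(1) parallel_Dom_Cod[OF cells(1)] E_Dom[OF Suc.prems(3)] E_Cod[OF Suc.prems(3)]
      by (intro Suc.IH) (simp_all add: d y)
    then obtain y1 where y1: "(y, y1) \<in> E j" "dom_to M k j y1 = Dom M k p"
        "cod_to M k j y1 = Cod M k p"
      by blast
    have y1j: "y1 \<in> Cell M j" using E_closed(2)[OF y1(1)] .
    show ?case
      using Suc.prems cells pq y1 y1j
      by (intro attach[OF _ y1(1)])
        (simp_all add: parallel_def d dom_to_closed cod_to_closed)
  }
qed

text \<open>
  To prescribe the source alone, a target parallel to \<open>p\<close> is needed; it comes from giving the old
  target the boundary of \<open>p\<close>.
\<close>

lemma replace_source:
  assumes y: "y \<in> Cell M j" and kj: "k < j" and p: "(p, dom_to M k j y) \<in> E k"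
  obtains y' where "(y, y') \<in> E j" "dom_to M k j y' = p"
proof -
  have "\<exists>q. parallel M k p q \<and> (q, cod_to M k j y) \<in> E k"
  proof (cases k)
    case 0
    then show ?thesis
      using p y kj E_closed(1)[OF p] E_refl[OF cod_to_closed[of k j y]]
      by (intro exI[of _ "cod_to M k j y"]) (auto simp: parallel_def intro: cod_to_closed)
  next
    case (Suc l)
    let ?c = "cod_to M (Suc l) j y"
    have pl: "(p, dom_to M (Suc l) j y) \<in> E (Suc l)" using p Suc by simp
    have c: "?c \<in> Cell M (Suc l)" using kj y Suc by (simp add: cod_to_closed)
    have d: "Dom M l (dom_to M (Suc l) j y) = dom_to M l (Suc l) ?c"
      "Cod M l (dom_to M (Suc l) j y) = cod_to M l (Suc l) ?c"
      using kj y Suc dom_to_dom_to[of l "Suc l" j y] cod_to_dom_to[of l "Suc l" j y]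
        dom_to_cod_to[of l "Suc l" j y] cod_to_cod_to[of l "Suc l" j y] by simp_all
    have "\<exists>q. (?c, q) \<in> E (Suc l) \<and> dom_to M l (Suc l) q = Dom M l p \<and>
        cod_to M l (Suc l) q = Cod M l p"
      using E_Dom[OF pl] E_Cod[OF pl] parallel_Dom_Cod[OF E_closed(1)[OF pl]]
      by (intro replace_boundary[OF c]) (simp_all only: d lessI)
    then obtain q where q: "(?c, q) \<in> E (Suc l)" "Dom M l q = Dom M l p" "Cod M l q = Cod M l p"
      by auto
    then have "parallel M (Suc l) p q"
      using E_closed(1)[OF pl] E_closed(2)[OF q(1)] by (simp add: parallel_def)
    then show ?thesis using E_sym[OF q(1)] unfolding Suc by blast
  qed
  then show thesis using replace_boundary[OF y kj _ p] that by blast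
qed

section \<open>Strictness of the quotient\<close>

text \<open>
  Lifting the cells in a law one after the other, each to a cell composable with its predecessor,
  makes the law up to \<open>E\<close> applicable; the image of that relation is the law.
\<close>

lemma strict_quotient:
  assumes P: "omega_magma P" and F: "omega_magma_morphism M P F"
    and surj: "\<And>j A. A \<in> Cell P j \<Longrightarrow> \<exists>x \<in> Cell M j. F j x = A"
    and kernel: "\<And>j x y. x \<in> Cell M j \<Longrightarrow> y \<in> Cell M j \<Longrightarrow> F j x = F j y \<longleftrightarrow> (x, y) \<in> E j"
  shows "strict_omega_category P"
proof -
  interpret P: omega_magma P by (rule P)
  note Fm = omega_magma_morphismD[OF F]
  have F_eqI: "F j x = F j y" if "(x, y) \<in> E j" for j x y
    using kernel E_closed[OF that] that by simp
  have lift: "\<exists>y. B = F j y \<and> composable M i j x y"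
    if x: "x \<in> Cell M j" and c: "composable P i j (F j x) B" for i j x B
  proof -
    have ij: "i < j" using c by (simp add: composable_def)
    obtain y where y: "y \<in> Cell M j" "F j y = B"
      using c surj by (auto simp: composable_def)
    have "F i (cod_to M i j x) = F i (dom_to M i j y)"
      using c x y ij morphism_cod_to[OF Fm(6) globular_set_axioms, of i j x]
        morphism_dom_to[OF Fm(6) globular_set_axioms, of i j y]
      by (simp add: composable_def)
    then have "(cod_to M i j x, dom_to M i j y) \<in> E i"
      using x y ij by (simp add: kernel cod_to_closed dom_to_closed)
    from replace_source[OF y(1) ij this]
    obtain y' where y': "(y, y') \<in> E j" "dom_to M i j y' = cod_to M i j x" by blast
    then have "B = F j y'" "composable M i j x y'"
      using F_eqI[OF y'(1)] E_closed(2)[OF y'(1)] x y ij by (simp_all add: composable_def)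
    then show ?thesis by blast
  qed
  have lift2: "\<exists>x y. A = F j x \<and> B = F j y \<and> composable M i j x y"
    if c: "composable P i j A B" for i j A B
  proof -
    obtain x where "x \<in> Cell M j" "F j x = A" using surj c by (auto simp: composable_def)
    then show ?thesis using lift c by blast
  qed
  have cells: "x \<in> Cell M j" "y \<in> Cell M j" if "composable M i j x y" for i j x y
    using that by (simp_all add: composable_def)
  show ?thesis
  proof
    fix i j a b c
    assume h: "composable P i j a b" "composable P i j b c"
    obtain x y where x: "a = F j x" "b = F j y" "composable M i j x y"
      using lift2[OF h(1)] by blast
    obtain z where z: "c = F j z" "composable M i j y z"
      using lift[OF cells(2)[OF x(3)]] h(2) x(2) by blast
    show "Comp P i j (Comp P i j a b) c = Comp P i j a (Comp P i j b c)"
      using F_eqI[OF assoc_up_to[OF x(3) z(2)]] x z composable_assoc[OF x(3) z(2)]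
      by (simp add: Fm(5))
  next
    fix i j k :: nat and a b c d
    assume ij: "i < j"
      and h: "composable P j k a b" "composable P j k c d" "composable P i k a c"
    obtain x y where x: "a = F k x" "b = F k y" "composable M j k x y"
      using lift2[OF h(1)] by blast
    obtain z where z: "c = F k z" "composable M i k x z"
      using lift[OF cells(1)[OF x(3)]] h(3) x(1) by blast
    obtain w where w: "d = F k w" "composable M j k z w"
      using lift[OF cells(2)[OF z(2)]] h(2) z(1) by blast
    show "Comp P i k (Comp P j k a b) (Comp P j k c d) = Comp P j k (Comp P i k a c) (Comp P i k b d)"
      using F_eqI[OF interchange_up_to[OF ij x(3) w(2) z(2)]] x z w
        composable_interchange[OF ij x(3) w(2) z(2)]
      by (simp add: Fm(5))
  next
    fix i j :: nat and a assume ij: "i < j" and "a \<in> Cell P j"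
    then obtain x where x: "x \<in> Cell M j" "a = F j x" using surj by blast
    show "Comp P i j (id_to P i j (dom_to P i j a)) a = a"
      using F_eqI[OF id_left_up_to[OF ij x(1)]] x ij dom_to_closed[of i j x]
      by (simp add: Fm(5) composable_id_left morphism_id_to[OF Fm(7) omega_graph_axioms]
          morphism_dom_to[OF Fm(6) globular_set_axioms])
    show "Comp P i j a (id_to P i j (cod_to P i j a)) = a"
      using F_eqI[OF id_right_up_to[OF ij x(1)]] x ij cod_to_closed[of i j x]
      by (simp add: Fm(5) composable_id_right morphism_id_to[OF Fm(7) omega_graph_axioms]
          morphism_cod_to[OF Fm(6) globular_set_axioms])
  next
    fix i j a b assume h: "composable P i j a b"
    obtain x y where x: "a = F j x" "b = F j y" "composable M i j x y"
      using lift2[OF h] by blast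
    show "Comp P i (Suc j) (Idn P j a) (Idn P j b) = Idn P j (Comp P i j a b)"
      using F_eqI[OF Idn_Comp_up_to[OF x(3)]] x composable_Idn[OF x(3)] cells[OF x(3)]
      by (simp add: Fm(4,5) Comp_closed)
  qed
qed

end

section \<open>The quotient map as a categorical Penon morphism\<close>

theorem theorem29:
  fixes M :: "'a omega_magma"
    and R :: "nat \<Rightarrow> ('a \<times> 'a \<times> 'a) set"
    and E :: "nat \<Rightarrow> ('a \<times> 'a) set"
  assumes "bridge_magma M R"
    and "omega_magma_equivalence M E"
    and "sharp M E"
    and "categorical M E"
    and "witness M E R"
  shows "categorical_Penon_morphism M R (M //\<^sub>\<omega> E) (diagonal_bridge (M //\<^sub>\<omega> E)) (quotient_map M E)"
proof -
  interpret M: omega_magma M using assms(1) by (simp add: bridge_magma_def)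
  interpret sharp_equivalence M E
    by unfold_locales (fact assms(2,3))+
  interpret witnessed_equivalence M E R
    using assms(1) by unfold_locales (auto simp: bridge_magma_def assms(4,5))
  let ?P = "M //\<^sub>\<omega> E"
  interpret P: omega_magma ?P by (rule quotient_magma)
  have strict: "strict_omega_category ?P"
    by (rule strict_quotient[OF quotient_magma quotient_map_morphism quotient_map_surj
          quotient_map_kernel])
  have collapse: "\<kappa> i a = \<kappa> i b \<and> \<kappa> (Suc i) c = Idn ?P i (\<kappa> i a) \<and> \<kappa> i a \<in> Cell ?P i"
    if "(a, b, c) \<in> R i" for i a b c
  proof -
    have "(a, b) \<in> E i" "(c, Idn M i a) \<in> E (Suc i)"
      using that assms(5) unfolding witness_def by blast+
    then show ?thesis
      using quotient_map_eqI E_closed(1) omega_magma_morphismD(1,4)[OF quotient_map_morphism]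
      by metis
  qed
  have "bridge_morphism M R ?P (diagonal_bridge ?P) \<kappa>"
    using assms(1) P.bridge_magma_diagonal quotient_map_morphism collapse
    by (fastforce simp: bridge_morphism_def diagonal_bridge_def)
  moreover have "\<exists>c. (a, b, c) \<in> R i" if "parallel M i a b" "\<kappa> i a = \<kappa> i b" for i a b
    using that assms(5) quotient_map_kernel[of a i b] unfolding witness_def parallel_def by blast
  ultimately show ?thesis
    using strict collapse by (simp add: categorical_Penon_morphism_def)
qed

end
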